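(* Let $S=\{u=F(x,y)\}$ be a local real-analytic surface in $\mathbb{R}^3$, where $F$ is real-analytic on a connected open subset of $\mathbb{R}^2$, such that at every point $F_{xx}\neq 0$ and $F_{xx}F_{xxy}-F_{xy}F_{xxx}\neq0$, and such that the Hessian vanishes identically: $$0\equiv F_{xx}F_{yy}-(F_{xy})^2.$$ Then $S$ is locally affinely equivalent to the model surface $u=\frac{x^2}{1-y}$ if and only if both of the following identities hold: $$0\equiv 2\,F_{xy}\,(F_{xxx})^2-2\,F_{xx}\,F_{xxx}\,F_{xxy}+(F_{xx})^2\,F_{xxxy}-F_{xx}\,F_{xy}\,F_{xxxx},$$ $$0\equiv 9\,(F_{xx})^2\,F_{xxxxx}-45\,F_{xx}\,F_{xxx}\,F_{xxxx}+40\,(F_{xxx})^3.$$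
   Context: Coordinates on $\mathbb{R}^3$ are $(x,y,u)$; subscripts denote partial derivatives. "Locally affinely equivalent" means: every point of $S$ has a neighbourhood in $S$ which is mapped onto an open subset of the model surface by some invertible real affine transformation $\mathbf x\mapsto A\mathbf x+b$ of $\mathbb{R}^3$, with $A\in \mathrm{GL}_3(\mathbb{R})$, $b\in\mathbb{R}^3$. *)

theory Defs
  imports "HOL-Analysis.Analysis"
begin

text \<open>
  Real-analyticity in two variables: near every point of \<open>U\<close> the function is the sum of a
  double power series. Summability over \<open>UNIV\<close> is unordered, i.e. absolute, convergence.
\<close>
definition real_analytic_at2 :: "(real \<times> real \<Rightarrow> real) \<Rightarrow> real \<times> real \<Rightarrow> bool" where
  "real_analytic_at2 F p \<longleftrightarrow>
     (\<exists>r>0. \<exists>c :: nat \<Rightarrow> nat \<Rightarrow> real. \<forall>x y.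
        \<bar>x - fst p\<bar> < r \<longrightarrow> \<bar>y - snd p\<bar> < r \<longrightarrow>
        ((\<lambda>(i, j). c i j * (x - fst p) ^ i * (y - snd p) ^ j) has_sum F (x, y)) UNIV)"

definition real_analytic_on2 :: "(real \<times> real \<Rightarrow> real) \<Rightarrow> (real \<times> real) set \<Rightarrow> bool" where
  "real_analytic_on2 F U \<longleftrightarrow> (\<forall>p\<in>U. real_analytic_at2 F p)"

definition pdx :: "(real \<times> real \<Rightarrow> real) \<Rightarrow> real \<times> real \<Rightarrow> real" where
  "pdx F p = deriv (\<lambda>t. F (t, snd p)) (fst p)"

definition pdy :: "(real \<times> real \<Rightarrow> real) \<Rightarrow> real \<times> real \<Rightarrow> real" where
  "pdy F p = deriv (\<lambda>t. F (fst p, t)) (snd p)"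

text \<open>Subscripts are read from left to right: \<open>F_xxy\<close> is \<open>pdy (pdx (pdx F))\<close>.\<close>

abbreviation "D_xx F \<equiv> pdx (pdx F)"
abbreviation "D_xy F \<equiv> pdy (pdx F)"
abbreviation "D_yy F \<equiv> pdy (pdy F)"
abbreviation "D_xxx F \<equiv> pdx (pdx (pdx F))"
abbreviation "D_xxy F \<equiv> pdy (pdx (pdx F))"
abbreviation "D_xxxx F \<equiv> pdx (pdx (pdx (pdx F)))"
abbreviation "D_xxxy F \<equiv> pdy (pdx (pdx (pdx F)))"
abbreviation "D_xxxxx F \<equiv> pdx (pdx (pdx (pdx (pdx F))))"

definition graph_surface :: "(real \<times> real \<Rightarrow> real) \<Rightarrow> (real \<times> real) set \<Rightarrow> (real ^ 3) set" where
  "graph_surface F U = {vector [x, y, F (x, y)] | x y. (x, y) \<in> U}"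

text \<open>
  The model is taken on its whole natural domain \<open>y \<noteq> 1\<close>. Its two sheets are exchanged by the
  affine map \<open>(x, y, u) \<mapsto> (x, 2 - y, - u)\<close>, so keeping only one of them would give the same
  notion of local affine equivalence to the model.
\<close>
definition model_surface :: "(real ^ 3) set" where
  "model_surface = graph_surface (\<lambda>(x, y). x\<^sup>2 / (1 - y)) {(x, y). y \<noteq> 1}"

definition locally_affinely_equivalent :: "(real ^ 3) set \<Rightarrow> (real ^ 3) set \<Rightarrow> bool" where
  "locally_affinely_equivalent S M \<longleftrightarrow>
     (\<forall>p\<in>S. \<exists>N (A :: real ^ 3 ^ 3) (b :: real ^ 3).
        openin (top_of_set S) N \<and> p \<in> N \<and> invertible A \<and>
        openin (top_of_set M) ((\<lambda>v. A *v v + b) ` N))"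

end

theory Submission
  imports Defs
begin

text \<open>
  With \<open>m = F_xy / F_xx\<close> the vanishing Hessian gives \<open>m_y = m m_x\<close>, and the first identity is
  \<open>F_xx ^ 3 * m_xx = 0\<close>. It expresses that the rulings all pass through the fixed vertex
  \<open>(x0, y0) = (x - m / m_x, y + 1 / m_x)\<close>, so that the surface is a cone. The second identity is Monge's
  differential equation of conics for the slices \<open>y = const\<close>. A cone over a conic which is a
  graph is a quadratic cone minus a line, that is, an affine image of the model. Conversely, both
  identities follow by repeatedly differentiating the quadratic equation of the model along
  the surface and eliminating the coefficients.
\<close>

section \<open>Double power series\<close>

text \<open>The degenerate Hessian makes \<open>m\<close> constant along the ruling direction
  \<open>(- m, 1)\<close>, and the remaining nonvanishing hypothesis says
  \<open>F_xx ^ 2 * m_x \<noteq> 0\<close>, which is what makes the vertex a finite point. The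
  vertex of any such surface is stationary along a ruling, so its \<open>y\<close>-derivative is
  \<open>m\<close> times its \<open>x\<close>-derivative and the single equation
  \<open>m_xx = 0\<close> freezes it. Monge's equation controls one slice at a time, and it is never
  differentiated in \<open>y\<close>. The conic found on one slice is carried to the neighbouring
  slices by scaling from the vertex. As the vertex lies outside the region where \<open>F\<close> is
  studied, homogeneity cannot be read off there and is integrated from the Euler relation along
  segments of a convex box. The final affine map is dictated by two requirements: the vertex goes to
  \<open>(0, 1, 0)\<close>, and the osculating conic of the slice, coned from the vertex, becomes
  the equation of the model.\<close>

lemma double_series_has_derivative:
  fixes c :: "nat \<Rightarrow> nat \<Rightarrow> real" and g :: "real \<Rightarrow> real"
  assumes S: "\<And>x. \<bar>x\<bar> < r \<Longrightarrow> ((\<lambda>(i, j). c i j * x ^ i * y ^ j) has_sum g x) UNIV"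
    and x: "\<bar>x\<bar> < r"
  obtains D where "(g has_field_derivative D) (at x)"
    and "((\<lambda>(i, j). (real (Suc i) * c (Suc i) j) * x ^ i * y ^ j) has_sum D) UNIV"
proof -
  \<comment> \<open>For fixed \<open>y\<close> the rows are summed first: \<open>a i\<close> is the
    coefficient of a one-variable series in \<open>x\<close>, and \<open>b i\<close> is its absolute
    majorant. Termwise differentiation of the first gives the derivative; of the second, absolute
    convergence of the differentiated double series.\<close>
  define b where "b i = (\<Sum>\<^sub>\<infinity>j. \<bar>c i j * y ^ j\<bar>)" for i
  define a where "a i = (\<Sum>\<^sub>\<infinity>j. c i j * y ^ j)" for i
  have S': "((\<lambda>(i, j). c i j * x ^ i * y ^ j) has_sum g x) (UNIV \<times> UNIV)" if "\<bar>x\<bar> < r" for x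
    using S[OF that] by simp
  have abs: "(\<lambda>(i, j). norm (c i j * x ^ i * y ^ j)) summable_on (UNIV \<times> UNIV)" if "\<bar>x\<bar> < r" for x
    using summable_on_iff_abs_summable_on_real[THEN iffD1, OF has_sum_imp_summable[OF S'[OF that]]]
    by (simp add: case_prod_unfold)
  have r: "r > 0" using x by linarith
  have row: "(\<lambda>j. norm (c i j * y ^ j)) summable_on UNIV" for i
  proof -
    \<comment> \<open>At the nonzero abscissa \<open>r/2\<close> the factor \<open>(r/2) ^ i\<close>
      can be divided out of the row.\<close>
    have "(\<lambda>j. norm (c i j * (r/2) ^ i * y ^ j)) summable_on UNIV"
      using summable_on_SigmaD1[OF abs[of "r/2"], of i] r by simp
    moreover have "norm (c i j * (r/2) ^ i * y ^ j) = norm (c i j * y ^ j) * (r/2) ^ i" for j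
      using r by (simp add: abs_mult)
    ultimately have "(\<lambda>j. norm (c i j * y ^ j) * (r/2) ^ i) summable_on UNIV" by simp
    then show ?thesis
      using r summable_on_cmult_left'[of "(r/2) ^ i" "\<lambda>j. norm (c i j * y ^ j)" UNIV] by simp
  qed
  have row_a: "((\<lambda>j. c i j * y ^ j) has_sum a i) UNIV" for i
    unfolding a_def by (rule has_sum_infsum[OF summable_on_iff_abs_summable_on_real[THEN iffD2, OF row]])
  have bnn: "0 \<le> b i" for i unfolding b_def by (intro infsum_nonneg) auto
  have b_sum: "summable (\<lambda>i. b i * z ^ i)" if "\<bar>z\<bar> < r" for z
  proof -
    have "(\<lambda>i. \<Sum>\<^sub>\<infinity>j. norm (c i j * z ^ i * y ^ j)) summable_on UNIV"
      using summable_on_Sigma_banach[OF abs[OF that]] by simp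
    moreover have "(\<Sum>\<^sub>\<infinity>j. norm (c i j * z ^ i * y ^ j)) = b i * \<bar>z\<bar> ^ i" for i
      unfolding b_def infsum_cmult_left'[symmetric]
      by (intro infsum_cong) (simp add: abs_mult power_abs)
    ultimately have "(\<lambda>i. norm (b i * z ^ i)) summable_on UNIV"
      using bnn by (simp add: abs_mult power_abs)
    then have "summable (\<lambda>i. norm (b i * z ^ i))" by (rule summable_on_imp_summable)
    then show ?thesis by (rule summable_norm_cancel)
  qed
  have g_sum: "(\<lambda>i. a i * z ^ i) sums g z" if "\<bar>z\<bar> < r" for z
  proof (rule has_sum_imp_sums, rule has_sum_SigmaD[OF S'[OF that]])
    show "((\<lambda>j. case (i, j) of (i, j) \<Rightarrow> c i j * z ^ i * y ^ j) has_sum a i * z ^ i) UNIV" for i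
      using has_sum_cmult_left[OF row_a[of i], of "z ^ i"] by (simp add: mult_ac)
  qed
  have dg0: "((\<lambda>z. \<Sum>n. a n * z ^ n) has_field_derivative (\<Sum>n. diffs a n * x ^ n)) (at x)"
    by (rule termdiffs_strong'[of r]) (use g_sum x in \<open>auto simp: sums_iff\<close>)
  have dg: "(g has_field_derivative (\<Sum>n. diffs a n * x ^ n)) (at x)"
  proof (rule DERIV_cong_ev[THEN iffD1, OF refl _ refl dg0])
    have "eventually (\<lambda>z. z \<in> {-r<..<r}) (nhds x)"
      by (rule eventually_nhds_in_open) (use x in auto)
    then show "\<forall>\<^sub>F z in nhds x. (\<Sum>n. a n * z ^ n) = g z"
      by eventually_elim (use g_sum in \<open>auto simp: sums_iff\<close>)
  qed
  have rowD: "((\<lambda>j. (real (Suc i) * c (Suc i) j) * x ^ i * y ^ j) has_sum diffs a i * x ^ i) UNIV" for i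
    using has_sum_cmult_right[OF row_a[of "Suc i"], of "real (Suc i) * x ^ i"] by (simp add: mult_ac diffs_def)
  have "summable (\<lambda>n. diffs b n * \<bar>x\<bar> ^ n)"
    by (rule termdiff_converges[of _ r]) (use b_sum x in auto)
  then have "(\<lambda>n. diffs b n * \<bar>x\<bar> ^ n) summable_on UNIV"
    using bnn by (subst summable_on_UNIV_nonneg_real_iff) (auto simp: diffs_def)
  moreover have "(\<Sum>\<^sub>\<infinity>j. norm ((real (Suc i) * c (Suc i) j) * x ^ i * y ^ j)) = diffs b i * \<bar>x\<bar> ^ i" for i
  proof -
    have "diffs b i * \<bar>x\<bar> ^ i = (real (Suc i) * \<bar>x\<bar> ^ i) * b (Suc i)" by (simp add: diffs_def)
    also have "\<dots> = (\<Sum>\<^sub>\<infinity>j. norm ((real (Suc i) * c (Suc i) j) * x ^ i * y ^ j))"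
      unfolding b_def infsum_cmult_right'[symmetric]
      by (intro infsum_cong) (simp add: abs_mult power_abs)
    finally show ?thesis by simp
  qed
  moreover have "(\<lambda>j. norm ((real (Suc i) * c (Suc i) j) * x ^ i * y ^ j)) summable_on UNIV" for i
    using has_sum_imp_summable[OF rowD] by (simp only: summable_on_iff_abs_summable_on_real[symmetric])
  ultimately have "(\<lambda>ij. norm ((\<lambda>(i, j). (real (Suc i) * c (Suc i) j) * x ^ i * y ^ j) ij))
      summable_on UNIV \<times> UNIV"
    by (intro summable_on_SigmaI[where g = "\<lambda>i. diffs b i * \<bar>x\<bar> ^ i"])
       (auto simp: has_sum_iff simp del: of_nat_Suc)
  then have "(\<lambda>(i, j). (real (Suc i) * c (Suc i) j) * x ^ i * y ^ j) summable_on UNIV \<times> UNIV"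
    by (simp only: summable_on_iff_abs_summable_on_real[symmetric])
  then obtain T where T: "((\<lambda>(i, j). (real (Suc i) * c (Suc i) j) * x ^ i * y ^ j) has_sum T) (UNIV \<times> UNIV)"
    unfolding summable_on_def by blast
  have "((\<lambda>i. diffs a i * x ^ i) has_sum T) UNIV"
    by (rule has_sum_SigmaD[OF T]) (use rowD in simp)
  then have "T = (\<Sum>n. diffs a n * x ^ n)" by (simp add: has_sum_imp_sums sums_unique)
  with dg T that show ?thesis by simp
qed

text \<open>Radius and coefficients stay visible because termwise differentiation preserves the
  radius: derivatives of every order live on the same square.\<close>

definition power_series2 ::
    "(real \<times> real \<Rightarrow> real) \<Rightarrow> real \<times> real \<Rightarrow> real \<Rightarrow> (nat \<Rightarrow> nat \<Rightarrow> real) \<Rightarrow> bool" where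
  "power_series2 F p r c \<longleftrightarrow> (\<forall>x y. \<bar>x - fst p\<bar> < r \<longrightarrow> \<bar>y - snd p\<bar> < r \<longrightarrow>
     ((\<lambda>(i, j). c i j * (x - fst p) ^ i * (y - snd p) ^ j) has_sum F (x, y)) UNIV)"

lemma power_series2D:
  "power_series2 F p r c \<Longrightarrow> \<bar>x - fst p\<bar> < r \<Longrightarrow> \<bar>y - snd p\<bar> < r \<Longrightarrow>
     ((\<lambda>(i, j). c i j * (x - fst p) ^ i * (y - snd p) ^ j) has_sum F (x, y)) UNIV"
  by (auto simp: power_series2_def)

lemma real_analytic_at2_iff:
  "real_analytic_at2 F p \<longleftrightarrow> (\<exists>r>0. \<exists>c. power_series2 F p r c)"
  by (simp add: real_analytic_at2_def power_series2_def)

lemma power_series2_pdx: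
  assumes F: "power_series2 F p r c" and x: "\<bar>x - fst p\<bar> < r" and y: "\<bar>y - snd p\<bar> < r"
  shows "((\<lambda>t. F (t, y)) has_field_derivative pdx F (x, y)) (at x)"
    and "((\<lambda>(i, j). (real (Suc i) * c (Suc i) j) * (x - fst p) ^ i * (y - snd p) ^ j)
           has_sum pdx F (x, y)) UNIV"
proof -
  define g where "g t = F (t + fst p, y)" for t
  have g: "((\<lambda>(i, j). c i j * t ^ i * (y - snd p) ^ j) has_sum g t) UNIV" if "\<bar>t\<bar> < r" for t
    using power_series2D[OF F, of "t + fst p" y] y that by (simp add: g_def)
  obtain D where D: "(g has_field_derivative D) (at (x - fst p))"
    and S: "((\<lambda>(i, j). (real (Suc i) * c (Suc i) j) * (x - fst p) ^ i * (y - snd p) ^ j) has_sum D) UNIV"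
    by (rule double_series_has_derivative[OF g x])
  have "((\<lambda>t. g (t + - fst p)) has_field_derivative D) (at x)"
    using D DERIV_shift[of g D x "- fst p"] by simp
  then have D': "((\<lambda>t. F (t, y)) has_field_derivative D) (at x)"
    by (simp add: g_def)
  then have "pdx F (x, y) = D"
    by (simp add: pdx_def DERIV_imp_deriv)
  with D' S show "((\<lambda>t. F (t, y)) has_field_derivative pdx F (x, y)) (at x)"
    and "((\<lambda>(i, j). (real (Suc i) * c (Suc i) j) * (x - fst p) ^ i * (y - snd p) ^ j)
           has_sum pdx F (x, y)) UNIV" by simp_all
qed

lemma power_series2_swap:
  "power_series2 F p r c \<Longrightarrow> power_series2 (\<lambda>(x, y). F (y, x)) (snd p, fst p) r (\<lambda>i j. c j i)"
  unfolding power_series2_def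
proof (intro allI impI)
  fix x y
  assume *: "\<forall>x y. \<bar>x - fst p\<bar> < r \<longrightarrow> \<bar>y - snd p\<bar> < r \<longrightarrow>
     ((\<lambda>(i, j). c i j * (x - fst p) ^ i * (y - snd p) ^ j) has_sum F (x, y)) UNIV"
    and "\<bar>x - fst (snd p, fst p)\<bar> < r" "\<bar>y - snd (snd p, fst p)\<bar> < r"
  then have "((\<lambda>(i, j). c i j * (y - fst p) ^ i * (x - snd p) ^ j) has_sum F (y, x)) (UNIV \<times> UNIV)"
    by simp
  then show "((\<lambda>(i, j). c j i * (x - fst (snd p, fst p)) ^ i * (y - snd (snd p, fst p)) ^ j) has_sum
         (case (x, y) of (x, y) \<Rightarrow> F (y, x))) UNIV"
    by (subst (asm) has_sum_swap) (simp add: mult_ac case_prod_unfold)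
qed

lemma power_series2_pdy:
  assumes F: "power_series2 F p r c" and x: "\<bar>x - fst p\<bar> < r" and y: "\<bar>y - snd p\<bar> < r"
  shows "((\<lambda>t. F (x, t)) has_field_derivative pdy F (x, y)) (at y)"
    and "((\<lambda>(i, j). (real (Suc j) * c i (Suc j)) * (x - fst p) ^ i * (y - snd p) ^ j)
           has_sum pdy F (x, y)) UNIV"
proof -
  have eq: "pdx (\<lambda>(x, y). F (y, x)) (y, x) = pdy F (x, y)"
    by (simp add: pdx_def pdy_def)
  note * = power_series2_pdx[OF power_series2_swap[OF F], of y x, unfolded eq]
  show "((\<lambda>t. F (x, t)) has_field_derivative pdy F (x, y)) (at y)"
    using * x y by simp
  have "((\<lambda>(i, j). (real (Suc i) * c j (Suc i)) * (y - snd p) ^ i * (x - fst p) ^ j)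
           has_sum pdy F (x, y)) (UNIV \<times> UNIV)"
    using * x y by simp
  then show "((\<lambda>(i, j). (real (Suc j) * c i (Suc j)) * (x - fst p) ^ i * (y - snd p) ^ j)
           has_sum pdy F (x, y)) UNIV"
    by (subst (asm) has_sum_swap) (simp add: mult_ac case_prod_unfold)
qed

lemma power_series2_pdx_pdy:
  assumes "power_series2 F p r c"
  shows "power_series2 (pdx F) p r (\<lambda>i j. real (Suc i) * c (Suc i) j)"
    and "power_series2 (pdy F) p r (\<lambda>i j. real (Suc j) * c i (Suc j))"
  unfolding power_series2_def using power_series2_pdx(2)[OF assms] power_series2_pdy(2)[OF assms]
  by blast+

section \<open>Partial derivatives and continuity of analytic functions on a set\<close>

lemma real_analytic_on2_pdx: "real_analytic_on2 F U \<Longrightarrow> real_analytic_on2 (pdx F) U"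
  and real_analytic_on2_pdy: "real_analytic_on2 F U \<Longrightarrow> real_analytic_on2 (pdy F) U"
  unfolding real_analytic_on2_def real_analytic_at2_iff using power_series2_pdx_pdy by blast+

lemma real_analytic_on2_DERIV:
  assumes "real_analytic_on2 F U" and "(x, y) \<in> U"
  shows "((\<lambda>t. F (t, y)) has_field_derivative pdx F (x, y)) (at x)"
    and "((\<lambda>t. F (x, t)) has_field_derivative pdy F (x, y)) (at y)"
proof -
  obtain r c where r: "r > 0" "power_series2 F (x, y) r c"
    using assms by (auto simp: real_analytic_on2_def real_analytic_at2_iff)
  show "((\<lambda>t. F (t, y)) has_field_derivative pdx F (x, y)) (at x)"
    "((\<lambda>t. F (x, t)) has_field_derivative pdy F (x, y)) (at y)"
    using power_series2_pdx(1)[OF r(2)] power_series2_pdy(1)[OF r(2)] r(1) by simp_all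
qed

text \<open>At the centre both mixed derivatives are sums of one double series, with its two integer
  factors exchanged.\<close>

lemma real_analytic_on2_pdx_pdy_commute:
  assumes "real_analytic_on2 F U" and "p \<in> U"
  shows "pdx (pdy F) p = pdy (pdx F) p"
proof -
  obtain r c where r: "r > 0" "power_series2 F p r c"
    using assms by (auto simp: real_analytic_on2_def real_analytic_at2_iff)
  have "((\<lambda>(i, j). (real (Suc i) * (real (Suc j) * c (Suc i) (Suc j))) * 0 ^ i * 0 ^ j)
           has_sum pdx (pdy F) p) UNIV"
    using power_series2_pdx(2)[OF power_series2_pdx_pdy(2)[OF r(2)], of "fst p" "snd p"] r(1) by simp
  moreover have "((\<lambda>(i, j). (real (Suc j) * (real (Suc i) * c (Suc i) (Suc j))) * 0 ^ i * 0 ^ j)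
           has_sum pdy (pdx F) p) UNIV"
    using power_series2_pdy(2)[OF power_series2_pdx_pdy(1)[OF r(2)], of "fst p" "snd p"] r(1) by simp
  ultimately show ?thesis
    by (simp add: mult.left_commute has_sum_unique del: of_nat_Suc)
qed

lemma real_analytic_on2_continuous:
  assumes "real_analytic_on2 F U" and "p \<in> U"
  shows "isCont F p"
proof -
  obtain r c where r: "r > 0" "power_series2 F p r c"
    using assms by (auto simp: real_analytic_on2_def real_analytic_at2_iff)
  define B where "B = ball (fst p) (r/2) \<times> ball (snd p) (r/2)"
  define f where "f = (\<lambda>(i, j) q. c i j * (fst q - fst p) ^ i * (snd q - snd p) ^ j)"
  have in_B: "\<bar>fst q - fst p\<bar> < r/2" "\<bar>snd q - snd p\<bar> < r/2" if "q \<in> B" for q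
    using that by (auto simp: B_def dist_real_def abs_minus_commute)
  have "uniform_limit B (\<lambda>X q. \<Sum>ij\<in>X. f ij q) F (finite_subsets_at_top UNIV)"
  proof (rule Weierstrass_m_test_general')
    \<comment> \<open>On the half-size box every term is dominated by its value at the corner, where
      the series converges absolutely.\<close>
    show "norm (f ij q) \<le> norm (f ij (fst p + r/2, snd p + r/2))" if "q \<in> B" for ij q
      using in_B[OF that] r(1)
      by (cases ij) (auto simp: f_def abs_mult power_abs intro!: mult_mono power_mono)
    have "(\<lambda>ij. f ij (fst p + r/2, snd p + r/2)) summable_on UNIV"
      using power_series2D[OF r(2), of "fst p + r/2" "snd p + r/2"] r(1)
      by (auto simp: f_def case_prod_unfold has_sum_imp_summable)
    then show "(\<lambda>ij. norm (f ij (fst p + r/2, snd p + r/2))) summable_on UNIV"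
      by (rule summable_on_iff_abs_summable_on_real[THEN iffD1])
    show "((\<lambda>ij. f ij q) has_sum F q) UNIV" if "q \<in> B" for q
      using power_series2D[OF r(2), of "fst q" "snd q"] in_B[OF that] r(1)
      by (auto simp: f_def case_prod_unfold)
  qed
  then have "continuous_on B F"
  proof (rule uniform_limit_theorem[rotated])
    show "\<forall>\<^sub>F X in finite_subsets_at_top UNIV. continuous_on B (\<lambda>q. \<Sum>ij\<in>X. f ij q)"
      by (intro always_eventually allI continuous_on_sum)
        (auto simp: f_def case_prod_unfold intro!: continuous_intros)
  qed auto
  moreover have "open B" "p \<in> B" using r(1) by (auto simp: B_def open_Times mem_Times_iff)
  ultimately show ?thesis using continuous_on_eq_continuous_at by blast
qed

section \<open>Conics and cones along a slice\<close>

lemma DERIV_zero_of_zero_on_open: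
  fixes h :: "real \<Rightarrow> real"
  assumes "open I" "x \<in> I" "\<And>t. t \<in> I \<Longrightarrow> h t = 0" "(h has_field_derivative D) (at x)"
  shows "D = 0"
proof -
  have "((\<lambda>_. 0) has_field_derivative D) (at x)"
    by (rule has_field_derivative_transform_within_open[OF assms(4,1,2)]) (use assms(3) in simp)
  then show ?thesis by (rule DERIV_unique) simp
qed

text \<open>Let \<open>Q = l2 * l3 - l1 ^ 2\<close>. Along the curve \<open>k\<close> is the partial
  derivative of \<open>Q\<close> in the second coordinate, \<open>k'\<close> its derivative in
  \<open>t\<close>, and \<open>P\<close> the constant second partial. From order three on, the
  derivatives of \<open>Q = 0\<close> are linear and homogeneous in \<open>k\<close>,
  \<open>k'\<close>, \<open>P\<close>.\<close>

lemma monge_of_conic: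
  fixes f f1 f2 f3 f4 f5 :: "real \<Rightarrow> real"
  assumes I: "open I" "x \<in> I"
    and d0: "\<And>t. t \<in> I \<Longrightarrow> (f has_field_derivative f1 t) (at t)"
    and d1: "\<And>t. t \<in> I \<Longrightarrow> (f1 has_field_derivative f2 t) (at t)"
    and d2: "\<And>t. t \<in> I \<Longrightarrow> (f2 has_field_derivative f3 t) (at t)"
    and d3: "\<And>t. t \<in> I \<Longrightarrow> (f3 has_field_derivative f4 t) (at t)"
    and d4: "\<And>t. t \<in> I \<Longrightarrow> (f4 has_field_derivative f5 t) (at t)"
    and conic: "\<And>t. t \<in> I \<Longrightarrow>
      (p1 * t + q1 * f t + r1)\<^sup>2 = (p2 * t + q2 * f t + r2) * (p3 * t + q3 * f t + r3)"
    and kappa: "q2 * (p3 * x + q3 * f x + r3) + q3 * (p2 * x + q2 * f x + r2)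
                  - 2 * q1 * (p1 * x + q1 * f x + r1) \<noteq> 0"
    and f2: "f2 x \<noteq> 0"
  shows "9 * (f2 x)\<^sup>2 * f5 x - 45 * f2 x * f3 x * f4 x + 40 * (f3 x) ^ 3 = 0"
proof -
  define l1 where "l1 t = p1 * t + q1 * f t + r1" for t
  define l2 where "l2 t = p2 * t + q2 * f t + r2" for t
  define l3 where "l3 t = p3 * t + q3 * f t + r3" for t
  define k where "k t = q2 * l3 t + q3 * l2 t - 2 * q1 * l1 t" for t
  define k' where "k' t = q2 * (p3 + q3 * f1 t) + q3 * (p2 + q2 * f1 t) - 2 * q1 * (p1 + q1 * f1 t)" for t
  define P where "P = 2 * q2 * q3 - 2 * q1\<^sup>2"
  have dl1: "(l1 has_field_derivative p1 + q1 * f1 t) (at t)" if "t \<in> I" for t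
    unfolding l1_def using that by (auto intro!: derivative_eq_intros d0)
  have dl2: "(l2 has_field_derivative p2 + q2 * f1 t) (at t)" if "t \<in> I" for t
    unfolding l2_def using that by (auto intro!: derivative_eq_intros d0)
  have dl3: "(l3 has_field_derivative p3 + q3 * f1 t) (at t)" if "t \<in> I" for t
    unfolding l3_def using that by (auto intro!: derivative_eq_intros d0)
  have dk: "(k has_field_derivative k' t) (at t)" if "t \<in> I" for t
    unfolding k_def k'_def using that by (auto intro!: derivative_eq_intros dl1 dl2 dl3)
  have dk': "(k' has_field_derivative P * f2 t) (at t)" if "t \<in> I" for t
    unfolding k'_def P_def using that
    by (auto intro!: derivative_eq_intros d1 simp: algebra_simps power2_eq_square)
  note zero = DERIV_zero_of_zero_on_open[OF I(1)]
  have e0: "l2 t * l3 t - (l1 t)\<^sup>2 = 0" if "t \<in> I" for t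
    using conic[OF that] by (simp add: l1_def l2_def l3_def)
  have e1: "(p2 + q2 * f1 t) * l3 t + l2 t * (p3 + q3 * f1 t) - 2 * l1 t * (p1 + q1 * f1 t) = 0"
    if t: "t \<in> I" for t
    by (rule zero[OF t e0]) (use t in \<open>auto intro!: derivative_eq_intros dl1 dl2 dl3\<close>)
  have e2: "k t * f2 t + 2 * (p2 + q2 * f1 t) * (p3 + q3 * f1 t) - 2 * (p1 + q1 * f1 t)\<^sup>2 = 0"
    if t: "t \<in> I" for t
    by (rule zero[OF t e1])
      (use t in \<open>auto intro!: derivative_eq_intros dl1 dl2 dl3 d1
        simp: k_def algebra_simps power2_eq_square\<close>)
  have e3: "k t * f3 t + 3 * k' t * f2 t = 0" if t: "t \<in> I" for t
    by (rule zero[OF t e2])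
      (use t in \<open>auto intro!: derivative_eq_intros dk d1 d2
        simp: k'_def algebra_simps power2_eq_square\<close>)
  have e4: "k t * f4 t + 4 * k' t * f3 t + 3 * P * (f2 t)\<^sup>2 = 0" if t: "t \<in> I" for t
    by (rule zero[OF t e3])
      (use t in \<open>auto intro!: derivative_eq_intros dk dk' d2 d3
        simp: algebra_simps power2_eq_square\<close>)
  have e5: "k x * f5 x + 5 * k' x * f4 x + 10 * P * f2 x * f3 x = 0"
    by (rule zero[OF I(2) e4])
      (use I(2) in \<open>auto intro!: derivative_eq_intros dk dk' d2 d3 d4
        simp: algebra_simps power2_eq_square\<close>)
  note E = e3[OF I(2)] e4[OF I(2)] e5
  \<comment> \<open>\<open>9 * f2 ^ 2\<close> times the fifth-order relation minus
    \<open>30 * f2 * f3\<close> times the fourth cancels \<open>P\<close>; the third-order relation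
    then removes \<open>k'\<close>.\<close>
  have "k x * (9 * (f2 x)\<^sup>2 * f5 x - 45 * f2 x * f3 x * f4 x + 40 * (f3 x) ^ 3) = 0"
    using E by algebra
  moreover have "k x \<noteq> 0" using kappa by (simp add: k_def l1_def l2_def l3_def)
  ultimately show ?thesis by simp
qed

text \<open>
  At each \<open>t\<close> the form \<open>\<Psi> t\<close> is the osculating conic of the graph of \<open>f\<close> at \<open>t\<close>, cleared of
  denominators and evaluated at the fixed point \<open>(x, f x)\<close>. Monge's equation says that the osculating
  conic does not depend on \<open>t\<close>, in the form \<open>3 f'' \<Psi>' = 10 f''' \<Psi>\<close>.
\<close>
lemma conic_of_monge:
  fixes f f1 f2 f3 f4 f5 :: "real \<Rightarrow> real"
  assumes d0: "\<And>t. t \<in> {l<..<u} \<Longrightarrow> (f has_field_derivative f1 t) (at t)"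
    and d1: "\<And>t. t \<in> {l<..<u} \<Longrightarrow> (f1 has_field_derivative f2 t) (at t)"
    and d2: "\<And>t. t \<in> {l<..<u} \<Longrightarrow> (f2 has_field_derivative f3 t) (at t)"
    and d3: "\<And>t. t \<in> {l<..<u} \<Longrightarrow> (f3 has_field_derivative f4 t) (at t)"
    and d4: "\<And>t. t \<in> {l<..<u} \<Longrightarrow> (f4 has_field_derivative f5 t) (at t)"
    and f2: "\<And>t. t \<in> {l<..<u} \<Longrightarrow> f2 t \<noteq> 0"
    and monge: "\<And>t. t \<in> {l<..<u} \<Longrightarrow>
      9 * (f2 t)\<^sup>2 * f5 t - 45 * f2 t * f3 t * f4 t + 40 * (f3 t) ^ 3 = 0"
    and a: "a \<in> {l<..<u}" and x: "x \<in> {l<..<u}"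
    and g: "g = f x - f a - f1 a * (x - a)"
  shows "9 * (f2 a) ^ 4 * (x - a)\<^sup>2 =
    g * (18 * (f2 a) ^ 3 - 6 * (f2 a)\<^sup>2 * f3 a * (x - a) + (4 * (f3 a)\<^sup>2 - 3 * f2 a * f4 a) * g)"
proof -
  define G where "G t = f x - f t - f1 t * (x - t)" for t
  define \<Psi> where "\<Psi> t = G t * (18 * (f2 t) ^ 3 - 6 * (f2 t)\<^sup>2 * f3 t * (x - t)
      + (4 * (f3 t)\<^sup>2 - 3 * f2 t * f4 t) * G t) - 9 * (f2 t) ^ 4 * (x - t)\<^sup>2" for t
  define \<Psi>' where "\<Psi>' t = - f2 t * (x - t) * (18 * (f2 t) ^ 3 - 6 * (f2 t)\<^sup>2 * f3 t * (x - t)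
      + (4 * (f3 t)\<^sup>2 - 3 * f2 t * f4 t) * G t)
      + G t * (54 * (f2 t)\<^sup>2 * f3 t - 12 * f2 t * f3 t * f3 t * (x - t)
         - 6 * (f2 t)\<^sup>2 * f4 t * (x - t) + 6 * (f2 t)\<^sup>2 * f3 t
         + (8 * f3 t * f4 t - 3 * f3 t * f4 t - 3 * f2 t * f5 t) * G t
         - (4 * (f3 t)\<^sup>2 - 3 * f2 t * f4 t) * f2 t * (x - t))
      - 36 * (f2 t) ^ 3 * f3 t * (x - t)\<^sup>2 + 18 * (f2 t) ^ 4 * (x - t)" for t
  have dG: "(G has_field_derivative - f2 t * (x - t)) (at t)" if "t \<in> {l<..<u}" for t
    unfolding G_def using that by (auto intro!: derivative_eq_intros d0 d1)
  have d\<Psi>: "(\<Psi> has_field_derivative \<Psi>' t) (at t)" if t: "t \<in> {l<..<u}" for t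
    unfolding \<Psi>_def
    by (rule derivative_eq_intros dG[OF t] d2[OF t] d3[OF t] d4[OF t] refl)+
      (simp add: \<Psi>'_def algebra_simps power2_eq_square power3_eq_cube power4_eq_xxxx)
  \<comment> \<open>The fifth derivative occurs in \<open>\<Psi>'\<close> only through
    \<open>- 3 * f2 * f5 * G ^ 2\<close>; the factor \<open>3 * f2\<close> lets Monge's equation
    replace it.\<close>
  have key: "3 * f2 t * \<Psi>' t = 10 * f3 t * \<Psi> t" if "t \<in> {l<..<u}" for t
    using monge[OF that] unfolding \<Psi>_def \<Psi>'_def by algebra
  \<comment> \<open>The equation makes \<open>\<Psi>\<close> a constant multiple of the power 10/3
    of \<open>f2\<close>. Cubing avoids a fractional power of a possibly negative number; at
    \<open>t = x\<close> the form vanishes, so the constant is zero.\<close>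
  have "((\<lambda>t. (\<Psi> t) ^ 3 / (f2 t) ^ 10) has_field_derivative 0) (at t)" if t: "t \<in> {l<..<u}" for t
  proof (rule derivative_eq_intros d\<Psi>[OF t] d2[OF t] refl)+
    show "f2 t ^ 10 \<noteq> 0" using f2[OF t] by simp
    have "3 * (\<Psi> t)\<^sup>2 * \<Psi>' t * (f2 t) ^ 10 - (\<Psi> t) ^ 3 * (10 * (f2 t) ^ 9 * f3 t) = 0"
      using key[OF t] by algebra
    then show "(real 3 * (\<Psi>' t * \<Psi> t ^ (3 - Suc 0)) * f2 t ^ 10 -
        \<Psi> t ^ 3 * (real 10 * (f3 t * f2 t ^ (10 - Suc 0)))) / (f2 t ^ 10 * f2 t ^ 10) = 0"
      by (simp add: mult_ac)
  qed
  then have "(\<Psi> a) ^ 3 / (f2 a) ^ 10 = (\<Psi> x) ^ 3 / (f2 x) ^ 10"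
    using a x by (intro DERIV_isconst3[of l u]) auto
  moreover have "\<Psi> x = 0" by (simp add: \<Psi>_def G_def)
  ultimately have "\<Psi> a = 0" using f2[OF a] by simp
  then show ?thesis by (simp add: \<Psi>_def G_def g)
qed

text \<open>Here \<open>h\<close> is \<open>F_y\<close> on the slice and \<open>Y\<close> the height
  above the vertex. The first derivative of the Euler relation says that
  \<open>b / a = - (t - x0) / Y\<close> is affine in \<open>t\<close>; the conclusion is
  \<open>a ^ 3\<close> times the second derivative of \<open>b / a\<close>.\<close>

lemma cone_imp_W_zero:
  fixes f f1 h a b c d f3 f4 :: "real \<Rightarrow> real"
  assumes I: "open I" "x \<in> I"
    and cone: "\<And>t. t \<in> I \<Longrightarrow> f t - u0 = f1 t * (t - x0) + h t * Y"
    and "\<And>t. t \<in> I \<Longrightarrow> (f has_field_derivative f1 t) (at t)"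
    and "\<And>t. t \<in> I \<Longrightarrow> (f1 has_field_derivative a t) (at t)"
    and "\<And>t. t \<in> I \<Longrightarrow> (a has_field_derivative f3 t) (at t)"
    and "\<And>t. t \<in> I \<Longrightarrow> (f3 has_field_derivative f4 t) (at t)"
    and "\<And>t. t \<in> I \<Longrightarrow> (h has_field_derivative b t) (at t)"
    and "\<And>t. t \<in> I \<Longrightarrow> (b has_field_derivative c t) (at t)"
    and "\<And>t. t \<in> I \<Longrightarrow> (c has_field_derivative d t) (at t)"
    and a: "a x \<noteq> 0"
  shows "2 * b x * (f3 x)\<^sup>2 - 2 * a x * f3 x * c x + (a x)\<^sup>2 * d x - a x * b x * f4 x = 0"
proof -
  note D = assms(4-10)
  note zero = DERIV_zero_of_zero_on_open[OF I(1)]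
  have e0: "f t - u0 - f1 t * (t - x0) - h t * Y = 0" if "t \<in> I" for t
    using cone[OF that] by simp
  have e1: "a t * (t - x0) + b t * Y = 0" if t: "t \<in> I" for t
  proof -
    have "- (a t * (t - x0) + b t * Y) = 0"
      by (rule zero[OF t e0]) (use t in \<open>auto intro!: derivative_eq_intros D\<close>)
    then show ?thesis by simp
  qed
  have e2: "f3 t * (t - x0) + a t + c t * Y = 0" if t: "t \<in> I" for t
    by (rule zero[OF t e1]) (use t in \<open>auto intro!: derivative_eq_intros D\<close>)
  have e3: "f4 x * (x - x0) + 2 * f3 x + d x * Y = 0"
    by (rule zero[OF I(2) e2]) (use I(2) in \<open>auto intro!: derivative_eq_intros D\<close>)
  note E = e1[OF I(2)] e2[OF I(2)] e3
  \<comment> \<open>If \<open>Y = 0\<close>, the first relation forces \<open>x = x0\<close> and the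
    second then gives \<open>a x = 0\<close>.\<close>
  have "Y \<noteq> 0" using E a by auto
  moreover have "(2 * b x * (f3 x)\<^sup>2 - 2 * a x * f3 x * c x + (a x)\<^sup>2 * d x - a x * b x * f4 x) * Y = 0"
    using E by algebra
  ultimately show ?thesis by simp
qed

section \<open>The vertex of a parabolic graph\<close>

lemma real_analytic_on2_has_derivative:
  assumes "open U" and F: "real_analytic_on2 F U" and p: "(x, y) \<in> U"
  shows "(F has_derivative (\<lambda>(h, k). pdx F (x, y) * h + pdy F (x, y) * k)) (at (x, y))"
proof -
  obtain A B where AB: "open A" "open B" "x \<in> A" "y \<in> B" "A \<times> B \<subseteq> U"
    by (rule open_prod_elim[OF \<open>open U\<close> p]) (auto simp: mem_Times_iff)
  \<comment> \<open>The criterion by partial derivatives needs a convex set in the variable whose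
    partial is continuous.\<close>
  obtain e where e: "e > 0" "ball y e \<subseteq> B"
    by (rule openE[OF AB(2,4)])
  have sub: "A \<times> ball y e \<subseteq> U" using AB e by auto
  have "((\<lambda>(s, t). F (s, t)) has_derivative
      (\<lambda>(h, k). (*) (pdx F (x, y)) h + blinfun_apply (blinfun_mult_right (pdy F (x, y))) k))
      (at (x, y) within A \<times> ball y e)"
  proof (rule has_derivative_partialsI)
    show "((\<lambda>s. F (s, y)) has_derivative (*) (pdx F (x, y))) (at x within A)"
      using real_analytic_on2_DERIV(1)[OF F p]
      by (simp add: has_field_derivative_def has_derivative_at_withinI)
    show "((\<lambda>t. F (s, t)) has_derivative blinfun_apply (blinfun_mult_right (pdy F (s, t))))
        (at t within ball y e)" if "s \<in> A" "t \<in> ball y e" for s t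
    proof -
      have "(s, t) \<in> U" using sub that by blast
      from real_analytic_on2_DERIV(2)[OF F this] show ?thesis
        by (simp add: has_field_derivative_def has_derivative_at_withinI blinfun_mult_right.rep_eq)
    qed
    have "isCont (\<lambda>q. blinfun_mult_right (pdy F q)) (x, y)"
      by (rule bounded_linear.isCont[OF bounded_linear_blinfun_mult_right
            real_analytic_on2_continuous[OF real_analytic_on2_pdy[OF F] p]])
    then show "continuous (at (x, y) within A \<times> ball y e) (\<lambda>(s, t). blinfun_mult_right (pdy F (s, t)))"
      by (simp add: case_prod_unfold continuous_at_imp_continuous_at_within)
  qed (use e in auto)
  moreover have "at (x, y) within A \<times> ball y e = at (x, y)"
    by (rule at_within_open) (use AB e in \<open>auto intro: open_Times\<close>)
  ultimately show ?thesis by (simp add: blinfun_mult_right.rep_eq)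
qed

text \<open>The mixed derivatives agree only on \<open>U\<close>, so exchanging them below a further
  derivative requires a local congruence.\<close>

lemma pdy_cong:
  assumes "open U" "p \<in> U" and eq: "\<And>q. q \<in> U \<Longrightarrow> G q = H q"
  shows "pdy G p = pdy H p"
proof -
  have "open ((\<lambda>t. (fst p, t)) -` U)"
    by (rule open_vimage[OF \<open>open U\<close>]) (intro continuous_intros)
  then have "eventually (\<lambda>t. t \<in> (\<lambda>t. (fst p, t)) -` U) (nhds (snd p))"
    by (rule eventually_nhds_in_open) (use \<open>p \<in> U\<close> in simp)
  then have "eventually (\<lambda>t. G (fst p, t) = H (fst p, t)) (nhds (snd p))"
    by eventually_elim (use eq in auto)
  then show ?thesis unfolding pdy_def by (intro deriv_cong_ev) auto
qed

lemma real_analytic_on2_pdx_pdy_pdy: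
  assumes "open U" and G: "real_analytic_on2 G U" and p: "p \<in> U"
  shows "pdx (pdy (pdy G)) p = pdy (pdy (pdx G)) p"
  using real_analytic_on2_pdx_pdy_commute[OF real_analytic_on2_pdy[OF G] p]
    pdy_cong[OF \<open>open U\<close> p real_analytic_on2_pdx_pdy_commute[OF G]] by simp

lemma const_on_rectangle:
  fixes h :: "real \<times> real \<Rightarrow> real"
  assumes "\<And>x y. (x, y) \<in> {a<..<b} \<times> {c<..<d} \<Longrightarrow> ((\<lambda>t. h (t, y)) has_field_derivative 0) (at x)"
    and "\<And>x y. (x, y) \<in> {a<..<b} \<times> {c<..<d} \<Longrightarrow> ((\<lambda>t. h (x, t)) has_field_derivative 0) (at y)"
    and "(x, y) \<in> {a<..<b} \<times> {c<..<d}" "(x', y') \<in> {a<..<b} \<times> {c<..<d}"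
  shows "h (x, y) = h (x', y')"
proof -
  have "h (x, y) = h (x', y)"
    using DERIV_isconst3[of a b x x' "\<lambda>t. h (t, y)"] assms by auto
  also have "\<dots> = h (x', y')"
    using DERIV_isconst3[of c d y y' "\<lambda>t. h (x', t)"] assms by auto
  finally show ?thesis .
qed

text \<open>Turns the stationarity of a vertex coordinate, a regular term plus a quotient, into a
  polynomial identity.\<close>

lemma DERIV_quotient_zero:
  fixes f g h :: "real \<Rightarrow> real"
  assumes "(f has_field_derivative f') (at x)" "(g has_field_derivative g') (at x)"
    "(h has_field_derivative h') (at x)" "g x \<noteq> 0" "h' * (g x)\<^sup>2 + f' * g x = f x * g'"
  shows "((\<lambda>t. h t + f t / g t) has_field_derivative 0) (at x)"
proof (rule derivative_eq_intros assms refl)+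
  have "h' * (g x * g x) + (f' * g x - f x * g') = 0" using assms(5) by (simp add: power2_eq_square)
  then show "h' + (f' * g x - f x * g') / (g x * g x) = 0"
    using assms(4) by (simp add: divide_simps)
qed

text \<open>Dictionary: \<open>a, b, D\<close> are \<open>F_xx, F_xy, F_yy\<close>;
  \<open>c, d, e, cy\<close> are \<open>F_xxy, F_xxxy, F_xyy, F_xxyy\<close>; \<open>a3, a4\<close>
  are the pure \<open>x\<close>-derivatives; \<open>p, q\<close> is the gradient. With
  \<open>m = b / a\<close> one has \<open>S = a ^ 2 * m_x\<close>. The conclusions are the cleared
  derivatives of the three vertex coordinates, in \<open>x\<close> and then in
  \<open>y\<close>.\<close>

lemma vertex_identities:
  fixes a b c d e a3 a4 cy D p q :: real
  assumes H0: "a * D = b\<^sup>2" and H1: "a\<^sup>2 * e = 2 * a * b * c - b\<^sup>2 * a3"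
    and H2: "2 * a * a3 * e + a\<^sup>2 * cy = 2 * a * c\<^sup>2 + 2 * a * b * d - b\<^sup>2 * a4"
    and W: "2 * b * a3\<^sup>2 - 2 * a * a3 * c + a\<^sup>2 * d - a * b * a4 = 0"
    and a: "a \<noteq> 0"
  defines "S \<equiv> a * c - b * a3" and "Sx \<equiv> a * d - b * a4"
    and "Sy \<equiv> c\<^sup>2 + a * cy - e * a3 - b * d"
  shows "1 * S\<^sup>2 + (- (a3 * b + a * c)) * S = (- (a * b)) * Sx"
    and "0 * S\<^sup>2 + (2 * a * a3) * S = a\<^sup>2 * Sx"
    and "p * S\<^sup>2 + (2 * a * a3 * q + a\<^sup>2 * b - (a3 * b + a * c) * p - a * b * a) * S
      = (a\<^sup>2 * q - a * b * p) * Sx"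
    and "0 * S\<^sup>2 + (- (c * b + a * e)) * S = (- (a * b)) * Sy"
    and "1 * S\<^sup>2 + (2 * a * c) * S = a\<^sup>2 * Sy"
    and "q * S\<^sup>2 + (2 * a * c * q + a\<^sup>2 * D - (c * b + a * e) * p - a * b * b) * S
      = (a\<^sup>2 * q - a * b * p) * Sy"
proof -
  \<comment> \<open>This is \<open>m_xx = 0\<close>, read as
    \<open>(S / a ^ 2)_x = 0\<close>.\<close>
  have Sx: "a * Sx = 2 * a3 * S" unfolding Sx_def S_def using W by algebra
  show xx: "1 * S\<^sup>2 + (- (a3 * b + a * c)) * S = (- (a * b)) * Sx"
    using Sx S_def by algebra
  show yx: "0 * S\<^sup>2 + (2 * a * a3) * S = a\<^sup>2 * Sx" using Sx by algebra
  show "p * S\<^sup>2 + (2 * a * a3 * q + a\<^sup>2 * b - (a3 * b + a * c) * p - a * b * a) * S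
      = (a\<^sup>2 * q - a * b * p) * Sx" using xx yx by algebra
  \<comment> \<open>The outcome is \<open>m_xy = m_x ^ 2\<close>, the \<open>x\<close>-derivative of
    \<open>m_y = m * m_x\<close> once \<open>m_xx = 0\<close>.\<close>
  have "a\<^sup>2 * Sy = 3 * a\<^sup>2 * c\<^sup>2 + b * (a * Sx) - 3 * a3 * (a\<^sup>2 * e)"
    unfolding Sy_def Sx_def using H2 by algebra
  also have "\<dots> = S * (S + 2 * a * c)" unfolding Sx H1 S_def by algebra
  finally have Sy: "a\<^sup>2 * Sy = S * (S + 2 * a * c)" .
  then show yy: "1 * S\<^sup>2 + (2 * a * c) * S = a\<^sup>2 * Sy" by algebra
  have "a * (c * b + a * e) = b * (S + 2 * a * c)"
    unfolding S_def using H1 by algebra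
  then have "a * ((- (c * b + a * e)) * S) = a * ((- (a * b)) * Sy)"
    using Sy by algebra
  then have "(- (c * b + a * e)) * S = (- (a * b)) * Sy" using a mult_left_cancel by blast
  then show xy: "0 * S\<^sup>2 + (- (c * b + a * e)) * S = (- (a * b)) * Sy" by simp
  show "q * S\<^sup>2 + (2 * a * c * q + a\<^sup>2 * D - (c * b + a * e) * p - a * b * b) * S
      = (a\<^sup>2 * q - a * b * p) * Sy" proof -
    \<comment> \<open>Beyond the two coordinate identities only a multiple of the Hessian remains,
      since the displacement to the vertex lies in its kernel.\<close>
    have "q * S\<^sup>2 + (2 * a * c * q + a\<^sup>2 * D - (c * b + a * e) * p - a * b * b) * S
      = q * (1 * S\<^sup>2 + (2 * a * c) * S) + p * (0 * S\<^sup>2 + (- (c * b + a * e)) * S)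
        + a * (a * D - b\<^sup>2) * S" by algebra
    then show ?thesis unfolding xy yy H0 by algebra
  qed
qed

section \<open>Differential consequences of the vanishing Hessian\<close>

locale parabolic_graph =
  fixes F :: "real \<times> real \<Rightarrow> real" and U :: "(real \<times> real) set"
  assumes open_U: "open U"
    and analytic: "real_analytic_on2 F U"
    and Fxx: "\<And>p. p \<in> U \<Longrightarrow> D_xx F p \<noteq> 0"
    and S_nonzero: "\<And>p. p \<in> U \<Longrightarrow> D_xx F p * D_xxy F p - D_xy F p * D_xxx F p \<noteq> 0"
    and hessian: "\<And>p. p \<in> U \<Longrightarrow> D_xx F p * D_yy F p = (D_xy F p)\<^sup>2"
begin

lemmas analytics = analytic real_analytic_on2_pdx real_analytic_on2_pdy

text \<open>Mixed derivatives are normalised to have all \<open>x\<close> first, so that the algebra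
  sees one symbol per derivative.\<close>

lemma DERIV_x:
  assumes "(x, y) \<in> U"
  shows "((\<lambda>t. F (t, y)) has_field_derivative pdx F (x, y)) (at x)"
    "((\<lambda>t. pdx F (t, y)) has_field_derivative D_xx F (x, y)) (at x)"
    "((\<lambda>t. pdy F (t, y)) has_field_derivative D_xy F (x, y)) (at x)"
    "((\<lambda>t. D_xx F (t, y)) has_field_derivative D_xxx F (x, y)) (at x)"
    "((\<lambda>t. D_xy F (t, y)) has_field_derivative D_xxy F (x, y)) (at x)"
    "((\<lambda>t. D_yy F (t, y)) has_field_derivative pdy (D_xy F) (x, y)) (at x)"
    "((\<lambda>t. D_xxx F (t, y)) has_field_derivative D_xxxx F (x, y)) (at x)"
    "((\<lambda>t. D_xxy F (t, y)) has_field_derivative D_xxxy F (x, y)) (at x)"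
    "((\<lambda>t. pdy (D_xy F) (t, y)) has_field_derivative pdy (D_xxy F) (x, y)) (at x)"
    "((\<lambda>t. D_xxxx F (t, y)) has_field_derivative D_xxxxx F (x, y)) (at x)"
proof -
  note D = real_analytic_on2_DERIV(1)[OF _ assms]
  note A = analytics
  note C = real_analytic_on2_pdx_pdy_commute[OF _ assms]
  note C2 = real_analytic_on2_pdx_pdy_pdy[OF open_U _ assms]
  show "((\<lambda>t. F (t, y)) has_field_derivative pdx F (x, y)) (at x)"
    "((\<lambda>t. pdx F (t, y)) has_field_derivative D_xx F (x, y)) (at x)"
    "((\<lambda>t. D_xx F (t, y)) has_field_derivative D_xxx F (x, y)) (at x)"
    "((\<lambda>t. D_xxx F (t, y)) has_field_derivative D_xxxx F (x, y)) (at x)"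
    "((\<lambda>t. D_xxxx F (t, y)) has_field_derivative D_xxxxx F (x, y)) (at x)"
    by (intro D A)+
  show "((\<lambda>t. pdy F (t, y)) has_field_derivative D_xy F (x, y)) (at x)"
    using D[of "pdy F"] C[of F] A by simp
  show "((\<lambda>t. D_xy F (t, y)) has_field_derivative D_xxy F (x, y)) (at x)"
    using D[of "D_xy F"] C[of "pdx F"] A by simp
  show "((\<lambda>t. D_xxy F (t, y)) has_field_derivative D_xxxy F (x, y)) (at x)"
    using D[of "D_xxy F"] C[of "D_xx F"] A by simp
  show "((\<lambda>t. D_yy F (t, y)) has_field_derivative pdy (D_xy F) (x, y)) (at x)"
    using D[of "D_yy F"] C2[of F] A by simp
  show "((\<lambda>t. pdy (D_xy F) (t, y)) has_field_derivative pdy (D_xxy F) (x, y)) (at x)"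
    using D[of "pdy (D_xy F)"] C2[of "pdx F"] A by simp
qed

lemma DERIV_y:
  assumes "(x, y) \<in> U"
  shows "((\<lambda>t. F (x, t)) has_field_derivative pdy F (x, y)) (at y)"
    "((\<lambda>t. pdx F (x, t)) has_field_derivative D_xy F (x, y)) (at y)"
    "((\<lambda>t. pdy F (x, t)) has_field_derivative D_yy F (x, y)) (at y)"
    "((\<lambda>t. D_xx F (x, t)) has_field_derivative D_xxy F (x, y)) (at y)"
    "((\<lambda>t. D_xy F (x, t)) has_field_derivative pdy (D_xy F) (x, y)) (at y)"
    "((\<lambda>t. D_xxx F (x, t)) has_field_derivative D_xxxy F (x, y)) (at y)"
    "((\<lambda>t. D_xxy F (x, t)) has_field_derivative pdy (D_xxy F) (x, y)) (at y)"
  by (intro real_analytic_on2_DERIV(2)[OF _ assms] analytics)+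

lemma open_slice_x: "open {t. (t, y) \<in> U}"
proof -
  have "open ((\<lambda>t. (t, y)) -` U)"
    by (rule open_vimage[OF open_U]) (intro continuous_intros)
  then show ?thesis by (simp add: vimage_def)
qed

text \<open>This is \<open>m_y = m * m_x\<close> times \<open>F_xx ^ 3\<close>. Multiplying the
  differentiated Hessian by \<open>F_xx\<close> lets the Hessian itself eliminate
  \<open>F_yy\<close>.\<close>

lemma hessian_x:
  assumes "(x, y) \<in> U"
  shows "(D_xx F (x, y))\<^sup>2 * pdy (D_xy F) (x, y)
    = 2 * D_xx F (x, y) * D_xy F (x, y) * D_xxy F (x, y) - (D_xy F (x, y))\<^sup>2 * D_xxx F (x, y)"
proof -
  have "D_xxx F (x, y) * D_yy F (x, y) + D_xx F (x, y) * pdy (D_xy F) (x, y)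
      - 2 * D_xy F (x, y) * D_xxy F (x, y) = 0"
    by (rule DERIV_zero_of_zero_on_open[OF open_slice_x[of y],
          where h = "\<lambda>t. D_xx F (t, y) * D_yy F (t, y) - (D_xy F (t, y))\<^sup>2"])
      (use assms hessian in \<open>auto intro!: derivative_eq_intros DERIV_x\<close>)
  then show ?thesis using hessian[OF assms] by algebra
qed

text \<open>Supplies \<open>F_xxyy\<close>, which enters the \<open>y\<close>-derivative of
  \<open>S\<close>.\<close>

lemma hessian_xx:
  assumes "(x, y) \<in> U"
  shows "2 * D_xx F (x, y) * D_xxx F (x, y) * pdy (D_xy F) (x, y) + (D_xx F (x, y))\<^sup>2 * pdy (D_xxy F) (x, y)
    = 2 * D_xx F (x, y) * (D_xxy F (x, y))\<^sup>2 + 2 * D_xx F (x, y) * D_xy F (x, y) * D_xxxy F (x, y)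
      - (D_xy F (x, y))\<^sup>2 * D_xxxx F (x, y)"
proof -
  have "2 * D_xx F (x, y) * D_xxx F (x, y) * pdy (D_xy F) (x, y) + (D_xx F (x, y))\<^sup>2 * pdy (D_xxy F) (x, y)
      - (2 * D_xxx F (x, y) * D_xy F (x, y) * D_xxy F (x, y) + 2 * D_xx F (x, y) * (D_xxy F (x, y))\<^sup>2
         + 2 * D_xx F (x, y) * D_xy F (x, y) * D_xxxy F (x, y)
         - 2 * D_xy F (x, y) * D_xxy F (x, y) * D_xxx F (x, y)
         - (D_xy F (x, y))\<^sup>2 * D_xxxx F (x, y)) = 0"
    by (rule DERIV_zero_of_zero_on_open[OF open_slice_x[of y],
          where h = "\<lambda>t. (D_xx F (t, y))\<^sup>2 * pdy (D_xy F) (t, y)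
            - (2 * D_xx F (t, y) * D_xy F (t, y) * D_xxy F (t, y) - (D_xy F (t, y))\<^sup>2 * D_xxx F (t, y))"])
      (use assms hessian_x in \<open>auto intro!: derivative_eq_intros DERIV_x
          simp: algebra_simps power2_eq_square\<close>)
  then show ?thesis by simp
qed

abbreviation "S p \<equiv> D_xx F p * D_xxy F p - D_xy F p * D_xxx F p"
text \<open>
  Since the Hessian is degenerate, the gradient of \<open>F\<close> is constant along the lines in the kernel
  direction \<open>(- F_xy, F_xx)\<close>. The vertex at \<open>p\<close> is the point of the ruling through \<open>p\<close> where the
  neighbouring rulings accumulate; the surface is a cone iff it does not depend on \<open>p\<close>, and the
  \<open>x\<close>-derivatives of the vertex are multiples of the first invariant of the theorem.
\<close>
definition "vertex_x p = fst p - D_xx F p * D_xy F p / S p"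
definition "vertex_y p = snd p + (D_xx F p)\<^sup>2 / S p"
definition "vertex_u p = F p + (vertex_x p - fst p) * pdx F p + (vertex_y p - snd p) * pdy F p"

lemma DERIV_S:
  assumes "(x, y) \<in> U"
  shows "((\<lambda>t. S (t, y)) has_field_derivative
      D_xx F (x, y) * D_xxxy F (x, y) - D_xy F (x, y) * D_xxxx F (x, y)) (at x)"
    and "((\<lambda>t. S (x, t)) has_field_derivative
      (D_xxy F (x, y))\<^sup>2 + D_xx F (x, y) * pdy (D_xxy F) (x, y)
      - pdy (D_xy F) (x, y) * D_xxx F (x, y) - D_xy F (x, y) * D_xxxy F (x, y)) (at y)"
  using assms
  by (auto intro!: derivative_eq_intros DERIV_x DERIV_y simp: algebra_simps power2_eq_square)

lemma vertex_derivatives: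
  assumes p: "(x, y) \<in> U"
    and W: "2 * D_xy F (x, y) * (D_xxx F (x, y))\<^sup>2 - 2 * D_xx F (x, y) * D_xxx F (x, y) * D_xxy F (x, y)
       + (D_xx F (x, y))\<^sup>2 * D_xxxy F (x, y) - D_xx F (x, y) * D_xy F (x, y) * D_xxxx F (x, y) = 0"
  shows "((\<lambda>t. vertex_x (t, y)) has_field_derivative 0) (at x)"
    "((\<lambda>t. vertex_y (t, y)) has_field_derivative 0) (at x)"
    "((\<lambda>t. vertex_u (t, y)) has_field_derivative 0) (at x)"
    "((\<lambda>t. vertex_x (x, t)) has_field_derivative 0) (at y)"
    "((\<lambda>t. vertex_y (x, t)) has_field_derivative 0) (at y)"
    "((\<lambda>t. vertex_u (x, t)) has_field_derivative 0) (at y)"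
proof -
  note a0 = Fxx[OF p] and S0 = S_nonzero[OF p]
  note H0 = hessian[OF p] and H1 = hessian_x[OF p] and H2 = hessian_xx[OF p]
  \<comment> \<open>The coordinates are rewritten as a regular term plus a quotient by
    \<open>S\<close>, as \<open>DERIV_quotient_zero\<close> expects.\<close>
  have x: "vertex_x = (\<lambda>p. fst p + (- (D_xx F p * D_xy F p)) / S p)"
    by (rule ext) (simp add: vertex_x_def)
  have u: "vertex_u = (\<lambda>p. F p + ((D_xx F p)\<^sup>2 * pdy F p - D_xx F p * D_xy F p * pdx F p) / S p)"
    by (rule ext) (simp add: vertex_u_def vertex_x_def vertex_y_def diff_divide_distrib)
  note I = vertex_identities[OF H0 H1 H2 W a0]
  show "((\<lambda>t. vertex_x (t, y)) has_field_derivative 0) (at x)"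
    unfolding x
    by (rule DERIV_quotient_zero[OF _ DERIV_S(1)[OF p] _ S0,
          where h' = "1" and f' = "- (D_xxx F (x, y) * D_xy F (x, y) + D_xx F (x, y) * D_xxy F (x, y))"])
      ((auto intro!: derivative_eq_intros DERIV_x[OF p] simp: algebra_simps power2_eq_square)[2], rule I(1))
  show "((\<lambda>t. vertex_y (t, y)) has_field_derivative 0) (at x)"
    unfolding vertex_y_def
    by (rule DERIV_quotient_zero[OF _ DERIV_S(1)[OF p] _ S0,
          where h' = "0" and f' = "2 * D_xx F (x, y) * D_xxx F (x, y)"])
      ((auto intro!: derivative_eq_intros DERIV_x[OF p] simp: algebra_simps power2_eq_square)[2], rule I(2))
  show "((\<lambda>t. vertex_u (t, y)) has_field_derivative 0) (at x)"
    unfolding u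
    by (rule DERIV_quotient_zero[OF _ DERIV_S(1)[OF p] _ S0,
          where h' = "pdx F (x, y)" and f' = "2 * D_xx F (x, y) * D_xxx F (x, y) * pdy F (x, y) + (D_xx F (x, y))\<^sup>2 * D_xy F (x, y)
          - (D_xxx F (x, y) * D_xy F (x, y) + D_xx F (x, y) * D_xxy F (x, y)) * pdx F (x, y)
          - D_xx F (x, y) * D_xy F (x, y) * D_xx F (x, y)"])
      ((auto intro!: derivative_eq_intros DERIV_x[OF p] simp: algebra_simps power2_eq_square)[2], rule I(3))
  show "((\<lambda>t. vertex_x (x, t)) has_field_derivative 0) (at y)"
    unfolding x
    by (rule DERIV_quotient_zero[OF _ DERIV_S(2)[OF p] _ S0,
          where h' = "0" and f' = "- (D_xxy F (x, y) * D_xy F (x, y) + D_xx F (x, y) * pdy (D_xy F) (x, y))"])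
      ((auto intro!: derivative_eq_intros DERIV_y[OF p] simp: algebra_simps power2_eq_square)[2], rule I(4))
  show "((\<lambda>t. vertex_y (x, t)) has_field_derivative 0) (at y)"
    unfolding vertex_y_def
    by (rule DERIV_quotient_zero[OF _ DERIV_S(2)[OF p] _ S0,
          where h' = "1" and f' = "2 * D_xx F (x, y) * D_xxy F (x, y)"])
      ((auto intro!: derivative_eq_intros DERIV_y[OF p] simp: algebra_simps power2_eq_square)[2], rule I(5))
  show "((\<lambda>t. vertex_u (x, t)) has_field_derivative 0) (at y)"
    unfolding u
    by (rule DERIV_quotient_zero[OF _ DERIV_S(2)[OF p] _ S0,
          where h' = "pdy F (x, y)" and f' = "2 * D_xx F (x, y) * D_xxy F (x, y) * pdy F (x, y) + (D_xx F (x, y))\<^sup>2 * D_yy F (x, y)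
          - (D_xxy F (x, y) * D_xy F (x, y) + D_xx F (x, y) * pdy (D_xy F) (x, y)) * pdx F (x, y)
          - D_xx F (x, y) * D_xy F (x, y) * D_xy F (x, y)"])
      ((auto intro!: derivative_eq_intros DERIV_y[OF p] simp: algebra_simps power2_eq_square)[2], rule I(6))
qed

end

section \<open>Comparison with the model\<close>

text \<open>Along a ray from \<open>(x0, y0)\<close> the Euler relation says that
  \<open>(F - u0) / \<sigma>\<close> is stationary. Only scale factors between 1 and
  \<open>\<tau>\<close> are used: convexity keeps that segment in \<open>B\<close>, and
  \<open>\<tau> > 0\<close> keeps it away from the vertex at \<open>\<sigma> = 0\<close>.\<close>

lemma euler_imp_homogeneous:
  assumes U: "open U" "real_analytic_on2 F U" and B: "convex B" "B \<subseteq> U"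
    and euler: "\<And>x y. (x, y) \<in> B \<Longrightarrow>
      F (x, y) - u0 = pdx F (x, y) * (x - x0) + pdy F (x, y) * (y - y0)"
    and q: "(x1, y1) \<in> B" and \<tau>: "\<tau> > 0"
    and q': "(x0 + \<tau> * (x1 - x0), y0 + \<tau> * (y1 - y0)) \<in> B"
  shows "F (x0 + \<tau> * (x1 - x0), y0 + \<tau> * (y1 - y0)) - u0 = \<tau> * (F (x1, y1) - u0)"
proof -
  define path where "path \<sigma> = (x0 + \<sigma> * (x1 - x0), y0 + \<sigma> * (y1 - y0))" for \<sigma>
  define G where "G \<sigma> = (F (path \<sigma>) - u0) / \<sigma>" for \<sigma>
  have pos: "\<sigma> > 0" if "\<sigma> \<in> closed_segment 1 \<tau>" for \<sigma>
    using that \<tau> by (auto simp: closed_segment_eq_real_ivl split: if_splits)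
  have in_B: "path \<sigma> \<in> B" if "\<sigma> \<in> closed_segment 1 \<tau>" for \<sigma>
  proof -
    obtain v where v: "0 \<le> v" "v \<le> 1" "\<sigma> = (1 - v) *\<^sub>R 1 + v *\<^sub>R \<tau>"
      using \<open>\<sigma> \<in> closed_segment 1 \<tau>\<close> unfolding closed_segment_def by blast
    have "(1 - v) *\<^sub>R (x1, y1) + v *\<^sub>R path \<tau> \<in> B"
      using convexD_alt[OF B(1) q, of "path \<tau>" v] q' v by (simp add: path_def)
    moreover have "(1 - v) *\<^sub>R (x1, y1) + v *\<^sub>R path \<tau> = path \<sigma>"
      by (simp add: path_def v(3) algebra_simps)
    ultimately show ?thesis by simp
  qed
  have "(G has_field_derivative 0) (at \<sigma> within closed_segment 1 \<tau>)"
    if s: "\<sigma> \<in> closed_segment 1 \<tau>" for \<sigma>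
  proof -
    let ?D = "pdx F (path \<sigma>) * (x1 - x0) + pdy F (path \<sigma>) * (y1 - y0)"
    have dp: "(path has_derivative (\<lambda>h. (h * (x1 - x0), h * (y1 - y0)))) (at \<sigma>)"
      unfolding path_def by (auto intro!: derivative_eq_intros)
    have "path \<sigma> \<in> U" using in_B[OF s] B(2) by blast
    then have dF: "(F has_derivative (\<lambda>(h, k). pdx F (path \<sigma>) * h + pdy F (path \<sigma>) * k)) (at (path \<sigma>))"
      using real_analytic_on2_has_derivative[OF U, of "fst (path \<sigma>)" "snd (path \<sigma>)"] by simp
    have "((\<lambda>\<sigma>. F (path \<sigma>)) has_derivative
        (\<lambda>h. pdx F (path \<sigma>) * (h * (x1 - x0)) + pdy F (path \<sigma>) * (h * (y1 - y0)))) (at \<sigma>)"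
      using has_derivative_compose[OF dp dF] by simp
    moreover have "(\<lambda>h. pdx F (path \<sigma>) * (h * (x1 - x0)) + pdy F (path \<sigma>) * (h * (y1 - y0))) = (*) ?D"
      by (rule ext) (simp add: algebra_simps)
    ultimately have dFp: "((\<lambda>\<sigma>. F (path \<sigma>)) has_field_derivative ?D) (at \<sigma>)"
      by (simp add: has_field_derivative_def)
    have "F (path \<sigma>) - u0 = \<sigma> * ?D"
      using euler[of "fst (path \<sigma>)" "snd (path \<sigma>)"] in_B[OF s] by (simp add: path_def algebra_simps)
    then have "(G has_field_derivative 0) (at \<sigma>)"
      unfolding G_def using pos[OF s] by (auto intro!: derivative_eq_intros dFp)
    then show ?thesis by (rule has_field_derivative_at_within)
  qed
  then obtain c where c: "\<And>\<sigma>. \<sigma> \<in> closed_segment 1 \<tau> \<Longrightarrow> G \<sigma> = c"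
    using has_field_derivative_zero_constant[of "closed_segment 1 \<tau>" G] by auto
  have "G \<tau> = G 1" using c[of \<tau>] c[of 1] by simp
  then show ?thesis using \<tau> by (simp add: G_def path_def field_simps)
qed

text \<open>Reduces relative openness in the model to a membership test on an open set of the
  ambient space.\<close>

lemma openin_affine_image:
  fixes A :: "real ^ 'n ^ 'n"
  assumes A: "invertible A" and "open N" and eq: "\<And>v. v \<in> N \<Longrightarrow> A *v v + c \<in> M \<longleftrightarrow> v \<in> S"
  shows "openin (top_of_set M) ((\<lambda>v. A *v v + c) ` (S \<inter> N))"
proof -
  have "(\<lambda>v. A *v v + c) ` N = (+) c ` ((*v) A ` N)" by (auto simp: add.commute)
  moreover have "open ((*v) A ` N)"
    using open_bijective_linear_image_eq[of "(*v) A" N] A \<open>open N\<close> by (simp add: invertible_eq_bij)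
  ultimately have "open ((\<lambda>v. A *v v + c) ` N)" by (simp add: open_translation)
  moreover have "(\<lambda>v. A *v v + c) ` (S \<inter> N) = M \<inter> (\<lambda>v. A *v v + c) ` N"
    using eq by auto
  ultimately show ?thesis unfolding openin_open by blast
qed

lemma graph_surface_iff: "v \<in> graph_surface F U \<longleftrightarrow> (v $ 1, v $ 2) \<in> U \<and> v $ 3 = F (v $ 1, v $ 2)"
  by (auto simp: graph_surface_def vec_eq_iff forall_3 vector_3)

text \<open>The model is a quadratic cone with the ruling \<open>x = 0, y = 1\<close>
  removed.\<close>

lemma model_surface_iff: "v \<in> model_surface \<longleftrightarrow> v $ 2 \<noteq> 1 \<and> v $ 3 * (1 - v $ 2) = (v $ 1)\<^sup>2"
  unfolding model_surface_def graph_surface_iff by (auto simp: field_simps)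

lemma matrix_vector_mult_3:
  fixes A :: "real ^ 3 ^ 3"
  shows "(A *v v) $ i = A $ i $ 1 * v $ 1 + A $ i $ 2 * v $ 2 + A $ i $ 3 * v $ 3"
  by (simp add: matrix_vector_mult_def sum_3)

section \<open>The two implications, pointwise\<close>

context parabolic_graph
begin

lemma conditions_of_equivalent:
  fixes A :: "real ^ 3 ^ 3"
  assumes A: "invertible A" and V: "open V" "V \<subseteq> U" "(a, b) \<in> V"
    and model: "\<And>x y. (x, y) \<in> V \<Longrightarrow> A *v vector [x, y, F (x, y)] + c \<in> model_surface"
  shows "2 * D_xy F (a, b) * (D_xxx F (a, b))\<^sup>2 - 2 * D_xx F (a, b) * D_xxx F (a, b) * D_xxy F (a, b)
           + (D_xx F (a, b))\<^sup>2 * D_xxxy F (a, b) - D_xx F (a, b) * D_xy F (a, b) * D_xxxx F (a, b) = 0"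
    and "9 * (D_xx F (a, b))\<^sup>2 * D_xxxxx F (a, b) - 45 * D_xx F (a, b) * D_xxx F (a, b) * D_xxxx F (a, b)
           + 40 * (D_xxx F (a, b)) ^ 3 = 0"
proof -
  define L where "L i p = A $ i $ 1 * fst p + A $ i $ 2 * snd p + A $ i $ 3 * F p + c $ i" for i p
  have L: "(A *v vector [x, y, F (x, y)] + c) $ i = L i (x, y)" for i x y
    by (simp add: L_def matrix_vector_mult_3)
  have L2: "L 2 p \<noteq> 1" and Phi: "L 3 p * (1 - L 2 p) = (L 1 p)\<^sup>2" if "p \<in> V" for p
    using model[of "fst p" "snd p", unfolded model_surface_iff L] that by simp_all
  \<comment> \<open>\<open>\<Phi> 1\<close>, \<open>\<Phi> 2\<close>, \<open>\<Phi> 3\<close> are the partial derivatives in \<open>(x, y, u)\<close> of the quadratic form pulled back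
    from the model, which is homogeneous about the preimage \<open>v\<close> of the vertex \<open>(0, 1, 0)\<close>.\<close>
  define w :: "real \<times> real \<Rightarrow> real ^ 3" where "w p = vector [- 2 * L 1 p, - L 3 p, 1 - L 2 p]" for p
  define \<Phi> where "\<Phi> j p = (w p v* A) $ j" for j p
  have \<Phi>: "\<Phi> j p = (1 - L 2 p) * A $ 3 $ j - L 3 p * A $ 2 $ j - 2 * L 1 p * A $ 1 $ j" for j p
    by (simp add: \<Phi>_def w_def vector_matrix_mult_def sum_3 algebra_simps)
  have slices: "open {t. (t, y) \<in> V}" "open {t. (x, t) \<in> V}" for x y
  proof -
    have "open ((\<lambda>t. (t, y)) -` V)" "open ((\<lambda>t. (x, t)) -` V)"
      by (rule open_vimage[OF V(1)], intro continuous_intros)+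
    then show "open {t. (t, y) \<in> V}" "open {t. (x, t) \<in> V}" by (simp_all add: vimage_def)
  qed
  have dLx: "((\<lambda>t. L i (t, y)) has_field_derivative A $ i $ 1 + A $ i $ 3 * pdx F (x, y)) (at x)"
    and dLy: "((\<lambda>t. L i (x, t)) has_field_derivative A $ i $ 2 + A $ i $ 3 * pdy F (x, y)) (at y)"
    if "(x, y) \<in> V" for i x y
    unfolding L_def using that V(2) by (auto intro!: derivative_eq_intros DERIV_x DERIV_y)
  have \<Phi>x: "\<Phi> 1 (x, y) + \<Phi> 3 (x, y) * pdx F (x, y) = 0" if p: "(x, y) \<in> V" for x y
  proof -
    have "(A $ 3 $ 1 + A $ 3 $ 3 * pdx F (x, y)) * (1 - L 2 (x, y))
        - L 3 (x, y) * (A $ 2 $ 1 + A $ 2 $ 3 * pdx F (x, y))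
        - 2 * L 1 (x, y) * (A $ 1 $ 1 + A $ 1 $ 3 * pdx F (x, y)) = 0"
      by (rule DERIV_zero_of_zero_on_open[OF slices(1)[of y],
            where h = "\<lambda>t. L 3 (t, y) * (1 - L 2 (t, y)) - (L 1 (t, y))\<^sup>2"])
        (use p Phi in \<open>auto intro!: derivative_eq_intros dLx simp: algebra_simps\<close>)
    then show ?thesis unfolding \<Phi> by algebra
  qed
  have \<Phi>y: "\<Phi> 2 (x, y) + \<Phi> 3 (x, y) * pdy F (x, y) = 0" if p: "(x, y) \<in> V" for x y
  proof -
    have "(A $ 3 $ 2 + A $ 3 $ 3 * pdy F (x, y)) * (1 - L 2 (x, y))
        - L 3 (x, y) * (A $ 2 $ 2 + A $ 2 $ 3 * pdy F (x, y))
        - 2 * L 1 (x, y) * (A $ 1 $ 2 + A $ 1 $ 3 * pdy F (x, y)) = 0"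
      by (rule DERIV_zero_of_zero_on_open[OF slices(2)[of x],
            where h = "\<lambda>t. L 3 (x, t) * (1 - L 2 (x, t)) - (L 1 (x, t))\<^sup>2"])
        (use p Phi in \<open>auto intro!: derivative_eq_intros dLy simp: algebra_simps\<close>)
    then show ?thesis unfolding \<Phi> by algebra
  qed
  \<comment> \<open>Otherwise the whole gradient vanishes, hence \<open>w p = 0\<close>. But its
    last entry is \<open>1 - L 2 p\<close>: a quadratic cone is singular only at its vertex, which
    the model omits.\<close>
  have \<Phi>3: "\<Phi> 3 p \<noteq> 0" if p: "p \<in> V" for p
  proof
    assume "\<Phi> 3 p = 0"
    moreover from this have "\<Phi> 1 p = 0" "\<Phi> 2 p = 0"
      using \<Phi>x[of "fst p" "snd p"] \<Phi>y[of "fst p" "snd p"] p by simp_all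
    ultimately have "transpose A *v w p = 0"
      by (simp add: vec_eq_iff forall_3 \<Phi>_def)
    then have "w p = 0"
      using A matrix_left_invertible_ker[of "transpose A"] transpose_invertible[OF A]
      by (auto simp: invertible_left_inverse)
    then show False using L2[OF p] by (simp add: w_def vec_eq_iff forall_3)
  qed
  obtain B where B: "A ** B = mat 1" using A by (auto simp: invertible_right_inverse)
  define v where "v = B *v (vector [0, 1, 0] - c)"
  have "A *v v = vector [0, 1, 0] - c"
    by (simp add: v_def matrix_vector_mul_assoc B)
  then have "(A *v v) $ 1 = - c $ 1" "(A *v v) $ 2 = 1 - c $ 2" "(A *v v) $ 3 = - c $ 3" by simp_all
  note v = this[unfolded matrix_vector_mult_3]
  have cone: "F (x, y) - v $ 3 = pdx F (x, y) * (x - v $ 1) + pdy F (x, y) * (y - v $ 2)"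
    if p: "(x, y) \<in> V" for x y
  proof -
    \<comment> \<open>Euler's identity of degree two about \<open>v\<close>: the gradient paired
      with the displacement from \<open>v\<close> is twice the quadratic form.\<close>
    have "\<Phi> 1 (x, y) * (x - v $ 1) + \<Phi> 2 (x, y) * (y - v $ 2) + \<Phi> 3 (x, y) * (F (x, y) - v $ 3)
      = (1 - L 2 (x, y)) * (L 3 (x, y) - (A $ 3 $ 1 * v $ 1 + A $ 3 $ 2 * v $ 2 + A $ 3 $ 3 * v $ 3 + c $ 3))
        - L 3 (x, y) * (L 2 (x, y) - (A $ 2 $ 1 * v $ 1 + A $ 2 $ 2 * v $ 2 + A $ 2 $ 3 * v $ 3 + c $ 2))
        - 2 * L 1 (x, y) * (L 1 (x, y) - (A $ 1 $ 1 * v $ 1 + A $ 1 $ 2 * v $ 2 + A $ 1 $ 3 * v $ 3 + c $ 1))"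
      unfolding \<Phi> L_def[of _ "(x, y)", symmetric] by (simp add: L_def algebra_simps)
    also have "\<dots> = 2 * (L 3 (x, y) * (1 - L 2 (x, y)) - (L 1 (x, y))\<^sup>2)"
      unfolding v by (simp add: algebra_simps power2_eq_square)
    also have "\<dots> = 0" using Phi[OF p] by simp
    finally have "\<Phi> 3 (x, y) * (F (x, y) - v $ 3 - (pdx F (x, y) * (x - v $ 1) + pdy F (x, y) * (y - v $ 2))) = 0"
      using \<Phi>x[OF p] \<Phi>y[OF p] by algebra
    then show ?thesis using \<Phi>3[OF p] by simp
  qed
  have abU: "(a, b) \<in> U" using V by blast
  let ?I = "{t. (t, b) \<in> V}"
  have I: "open ?I" "a \<in> ?I" using slices V by auto
  have DI: "(t, b) \<in> U" if "t \<in> ?I" for t using that V by auto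
  show "2 * D_xy F (a, b) * (D_xxx F (a, b))\<^sup>2 - 2 * D_xx F (a, b) * D_xxx F (a, b) * D_xxy F (a, b)
           + (D_xx F (a, b))\<^sup>2 * D_xxxy F (a, b) - D_xx F (a, b) * D_xy F (a, b) * D_xxxx F (a, b) = 0"
    by (rule cone_imp_W_zero[OF I, where f = "\<lambda>t. F (t, b)" and ?f1.0 = "\<lambda>t. pdx F (t, b)"
          and h = "\<lambda>t. pdy F (t, b)" and a = "\<lambda>t. D_xx F (t, b)" and b = "\<lambda>t. D_xy F (t, b)"
          and c = "\<lambda>t. D_xxy F (t, b)" and d = "\<lambda>t. D_xxxy F (t, b)" and ?f3.0 = "\<lambda>t. D_xxx F (t, b)"
          and ?f4.0 = "\<lambda>t. D_xxxx F (t, b)" and ?u0.0 = "v $ 3" and ?x0.0 = "v $ 1" and Y = "b - v $ 2"])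
      (use cone DI abU in \<open>auto intro!: DERIV_x Fxx\<close>)
  show "9 * (D_xx F (a, b))\<^sup>2 * D_xxxxx F (a, b) - 45 * D_xx F (a, b) * D_xxx F (a, b) * D_xxxx F (a, b)
           + 40 * (D_xxx F (a, b)) ^ 3 = 0"
  proof (rule monge_of_conic[OF I, where f = "\<lambda>t. F (t, b)" and ?f1.0 = "\<lambda>t. pdx F (t, b)"
          and ?f2.0 = "\<lambda>t. D_xx F (t, b)" and ?f3.0 = "\<lambda>t. D_xxx F (t, b)"
          and ?f4.0 = "\<lambda>t. D_xxxx F (t, b)" and ?f5.0 = "\<lambda>t. D_xxxxx F (t, b)"])
    show "(A $ 1 $ 1 * t + A $ 1 $ 3 * F (t, b) + (A $ 1 $ 2 * b + c $ 1))\<^sup>2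
        = (A $ 3 $ 1 * t + A $ 3 $ 3 * F (t, b) + (A $ 3 $ 2 * b + c $ 3))
          * (- A $ 2 $ 1 * t + - A $ 2 $ 3 * F (t, b) + (1 - A $ 2 $ 2 * b - c $ 2))" if "t \<in> ?I" for t
    proof -
      have "A $ 1 $ 1 * t + A $ 1 $ 3 * F (t, b) + (A $ 1 $ 2 * b + c $ 1) = L 1 (t, b)"
        "A $ 3 $ 1 * t + A $ 3 $ 3 * F (t, b) + (A $ 3 $ 2 * b + c $ 3) = L 3 (t, b)"
        "- A $ 2 $ 1 * t + - A $ 2 $ 3 * F (t, b) + (1 - A $ 2 $ 2 * b - c $ 2) = 1 - L 2 (t, b)"
        by (simp_all add: L_def)
      moreover have "(L 1 (t, b))\<^sup>2 = L 3 (t, b) * (1 - L 2 (t, b))"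
        using Phi[of "(t, b)"] that by simp
      ultimately show ?thesis by (simp only:)
    qed
    \<comment> \<open>The nondegeneracy expression of the conic is exactly
      \<open>\<Phi> 3 (a, b)\<close>.\<close>
    show "A $ 3 $ 3 * (- A $ 2 $ 1 * a + - A $ 2 $ 3 * F (a, b) + (1 - A $ 2 $ 2 * b - c $ 2))
        + - A $ 2 $ 3 * (A $ 3 $ 1 * a + A $ 3 $ 3 * F (a, b) + (A $ 3 $ 2 * b + c $ 3))
        - 2 * A $ 1 $ 3 * (A $ 1 $ 1 * a + A $ 1 $ 3 * F (a, b) + (A $ 1 $ 2 * b + c $ 1)) \<noteq> 0"
      using \<Phi>3[OF V(3)] unfolding \<Phi> by (simp add: L_def algebra_simps)
  qed (use DI abU in \<open>auto intro!: DERIV_x Fxx\<close>)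
qed

text \<open>The osculating conic at \<open>a\<close> of the slice through \<open>b\<close>,
  homogenised with respect to the vertex: \<open>\<tau>\<close> is the scale factor from that slice,
  and \<open>X\<close>, \<open>G\<close> are \<open>\<tau>\<close> times the slice coordinates
  relative to the tangent line.\<close>

lemma quadratic_equation_of_conditions:
  assumes ab: "(a, b) \<in> U"
    and W: "\<And>p. p \<in> U \<Longrightarrow> 2 * D_xy F p * (D_xxx F p)\<^sup>2 - 2 * D_xx F p * D_xxx F p * D_xxy F p
       + (D_xx F p)\<^sup>2 * D_xxxy F p - D_xx F p * D_xy F p * D_xxxx F p = 0"
    and monge: "\<And>p. p \<in> U \<Longrightarrow> 9 * (D_xx F p)\<^sup>2 * D_xxxxx F p
       - 45 * D_xx F p * D_xxx F p * D_xxxx F p + 40 * (D_xxx F p) ^ 3 = 0"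
  obtains V y0 x0 u0 where "open V" "V \<subseteq> U" "(a, b) \<in> V" "b \<noteq> y0"
    and "\<And>x y \<tau> X G. (x, y) \<in> V \<Longrightarrow> \<tau> = (y - y0) / (b - y0) \<Longrightarrow> X = x - x0 - \<tau> * (a - x0) \<Longrightarrow>
      G = F (x, y) - u0 - \<tau> * (F (a, b) - u0) - pdx F (a, b) * X \<Longrightarrow>
      9 * (D_xx F (a, b)) ^ 4 * X\<^sup>2 = G * (18 * (D_xx F (a, b)) ^ 3 * \<tau>
        - 6 * (D_xx F (a, b))\<^sup>2 * D_xxx F (a, b) * X
        + (4 * (D_xxx F (a, b))\<^sup>2 - 3 * D_xx F (a, b) * D_xxxx F (a, b)) * G)"
proof -
  define x0 y0 u0 where "x0 = vertex_x (a, b)" and "y0 = vertex_y (a, b)" and "u0 = vertex_u (a, b)"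
  obtain I' J' where IJ: "open I'" "open J'" "a \<in> I'" "b \<in> J'" "I' \<times> J' \<subseteq> U"
    by (rule open_prod_elim[OF open_U ab]) (auto simp: mem_Times_iff)
  obtain d where d: "d > 0" "ball a d \<subseteq> I'" by (rule openE[OF IJ(1,3)])
  obtain e where e: "e > 0" "ball b e \<subseteq> J'" by (rule openE[OF IJ(2,4)])
  define B where "B = {a - d<..<a + d} \<times> {b - e<..<b + e}"
  have BU: "B \<subseteq> U"
    using IJ(5) d(2) e(2) unfolding B_def ball_eq_greaterThanLessThan by blast
  have abB: "(a, b) \<in> B" using d e by (simp add: B_def)
  have vertex: "vertex_x p = x0" "vertex_y p = y0" "vertex_u p = u0" if p: "p \<in> B" for p
  proof -
    have U: "(x, y) \<in> U" if "(x, y) \<in> {a - d<..<a + d} \<times> {b - e<..<b + e}" for x y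
      using BU that unfolding B_def by blast
    note D = vertex_derivatives[OF U W[OF U]]
    have "(fst p, snd p) \<in> {a - d<..<a + d} \<times> {b - e<..<b + e}"
      "(a, b) \<in> {a - d<..<a + d} \<times> {b - e<..<b + e}"
      using p abB by (simp_all add: B_def)
    note pp = this
    show "vertex_x p = x0" "vertex_y p = y0" "vertex_u p = u0"
      using const_on_rectangle[OF D(1,4) pp] const_on_rectangle[OF D(2,5) pp]
        const_on_rectangle[OF D(3,6) pp] by (simp_all add: x0_def y0_def u0_def)
  qed
  \<comment> \<open>\<open>vertex_u\<close> is the height of the tangent plane over the vertex, so
    its constancy is the Euler relation.\<close>
  have euler: "F (x, y) - u0 = pdx F (x, y) * (x - x0) + pdy F (x, y) * (y - y0)"
    if p: "(x, y) \<in> B" for x y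
    using vertex_u_def[of "(x, y)"] vertex[OF p] by (simp add: algebra_simps)
  have by0: "b \<noteq> y0"
    using Fxx[OF ab] S_nonzero[OF ab] by (simp add: y0_def vertex_y_def)
  \<comment> \<open>These are the points of \<open>B\<close> whose ray from the vertex meets the
    slice \<open>y = b\<close> inside the box, at a positive scale factor.\<close>
  define V where "V = B \<inter> {p. 0 < (snd p - y0) / (b - y0)} \<inter>
    {p. \<bar>fst p - x0 - (snd p - y0) / (b - y0) * (a - x0)\<bar> < d * ((snd p - y0) / (b - y0))}"
  have V_open: "open V"
    unfolding V_def using by0
    by (intro open_Int open_Collect_less continuous_intros)
      (auto simp: B_def open_Times)
  have abV: "(a, b) \<in> V" using abB by0 d by (simp add: V_def)
  have VU: "V \<subseteq> U" using BU by (auto simp: V_def)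
  have conic: "9 * (D_xx F (a, b)) ^ 4 * X\<^sup>2 = G * (18 * (D_xx F (a, b)) ^ 3 * \<tau>
        - 6 * (D_xx F (a, b))\<^sup>2 * D_xxx F (a, b) * X
        + (4 * (D_xxx F (a, b))\<^sup>2 - 3 * D_xx F (a, b) * D_xxxx F (a, b)) * G)"
    if p: "(x, y) \<in> V" and \<tau>: "\<tau> = (y - y0) / (b - y0)" and X: "X = x - x0 - \<tau> * (a - x0)"
      and G: "G = F (x, y) - u0 - \<tau> * (F (a, b) - u0) - pdx F (a, b) * X" for x y \<tau> X G
  proof -
    define x1 where "x1 = a + X / \<tau>"
    have pos: "\<tau> > 0" and "\<bar>X\<bar> < d * \<tau>" and pB: "(x, y) \<in> B"
      using p by (simp_all add: V_def \<tau> X)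
    then have "\<bar>X / \<tau>\<bar> < d" by (simp add: abs_divide divide_less_eq)
    then have x1: "x1 \<in> {a - d<..<a + d}" unfolding x1_def abs_less_iff by simp
    then have x1B: "(x1, b) \<in> B" using abB by (simp add: B_def)
    have X': "X = \<tau> * (x1 - a)" using pos by (simp add: x1_def)
    have "x0 + \<tau> * (x1 - x0) = x" using X X' by algebra
    moreover have "y0 + \<tau> * (b - y0) = y" using by0 by (simp add: \<tau>)
    ultimately have q: "(x0 + \<tau> * (x1 - x0), y0 + \<tau> * (b - y0)) = (x, y)" by simp
    have "convex B" unfolding B_def by (intro convex_Times) auto
    then have hom: "F (x, y) - u0 = \<tau> * (F (x1, b) - u0)"
      using euler_imp_homogeneous[OF open_U analytic _ BU euler x1B pos] pB unfolding q by blast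
    define g where "g = F (x1, b) - F (a, b) - pdx F (a, b) * (x1 - a)"
    have G': "G = \<tau> * g" unfolding G g_def hom X' by (simp add: algebra_simps)
    have U: "(t, b) \<in> U" if "t \<in> {a - d<..<a + d}" for t
      using BU abB that unfolding B_def by blast
    have "9 * (D_xx F (a, b)) ^ 4 * (x1 - a)\<^sup>2 = g * (18 * (D_xx F (a, b)) ^ 3
        - 6 * (D_xx F (a, b))\<^sup>2 * D_xxx F (a, b) * (x1 - a)
        + (4 * (D_xxx F (a, b))\<^sup>2 - 3 * D_xx F (a, b) * D_xxxx F (a, b)) * g)"
      by (rule conic_of_monge[of "a - d" "a + d" "\<lambda>t. F (t, b)" "\<lambda>t. pdx F (t, b)"
          "\<lambda>t. D_xx F (t, b)" "\<lambda>t. D_xxx F (t, b)" "\<lambda>t. D_xxxx F (t, b)" "\<lambda>t. D_xxxxx F (t, b)"])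
        (use U x1 d in \<open>auto intro!: DERIV_x Fxx monge simp: g_def\<close>)
    then show ?thesis unfolding X' G' by algebra
  qed
  show ?thesis
    by (rule that[OF V_open VU abV by0]) (erule (3) conic)
qed

lemma equivalent_of_conditions:
  assumes W: "\<And>p. p \<in> U \<Longrightarrow> 2 * D_xy F p * (D_xxx F p)\<^sup>2 - 2 * D_xx F p * D_xxx F p * D_xxy F p
       + (D_xx F p)\<^sup>2 * D_xxxy F p - D_xx F p * D_xy F p * D_xxxx F p = 0"
    and monge: "\<And>p. p \<in> U \<Longrightarrow> 9 * (D_xx F p)\<^sup>2 * D_xxxxx F p
       - 45 * D_xx F p * D_xxx F p * D_xxxx F p + 40 * (D_xxx F p) ^ 3 = 0"
  shows "locally_affinely_equivalent (graph_surface F U) model_surface"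
  unfolding locally_affinely_equivalent_def
proof
  fix p :: "real ^ 3"
  assume p: "p \<in> graph_surface F U"
  define a b where "a = p $ 1" and "b = p $ 2"
  have ab: "(a, b) \<in> U" and p3: "p $ 3 = F (a, b)"
    using p by (simp_all add: graph_surface_iff a_def b_def)
  obtain V y0 x0 u0 where V: "open V" "V \<subseteq> U" "(a, b) \<in> V" and by0: "b \<noteq> y0"
    and conic: "\<And>x y \<tau> X G. (x, y) \<in> V \<Longrightarrow> \<tau> = (y - y0) / (b - y0) \<Longrightarrow> X = x - x0 - \<tau> * (a - x0) \<Longrightarrow>
      G = F (x, y) - u0 - \<tau> * (F (a, b) - u0) - pdx F (a, b) * X \<Longrightarrow>
      9 * (D_xx F (a, b)) ^ 4 * X\<^sup>2 = G * (18 * (D_xx F (a, b)) ^ 3 * \<tau>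
        - 6 * (D_xx F (a, b))\<^sup>2 * D_xxx F (a, b) * X
        + (4 * (D_xxx F (a, b))\<^sup>2 - 3 * D_xx F (a, b) * D_xxxx F (a, b)) * G)"
  proof (rule quadratic_equation_of_conditions[OF ab W monge], goal_cases)
    case (3 V y0 x0 u0)
    show ?case by (rule 3(1)[OF 3(2-5)]) (erule (3) 3(6))
  qed
  define k where "k = D_xx F (a, b)"
  \<comment> \<open>In \<open>X ^ 2 = G * (l + m * X + n * G)\<close> substitute the Taylor
    expansion of \<open>G\<close> at \<open>a\<close>: orders two, three and four determine
    \<open>l\<close>, \<open>m\<close>, \<open>n\<close>.\<close>
  define l where "l = 2 / k"
  define m where "m = - 2 * D_xxx F (a, b) / (3 * k\<^sup>2)"
  define n where "n = (4 * (D_xxx F (a, b))\<^sup>2 - 3 * k * D_xxxx F (a, b)) / (9 * k ^ 4)"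
  define \<beta> where "\<beta> = 1 / (b - y0)"
  define f1 where "f1 = pdx F (a, b)"
  have k: "k \<noteq> 0" using Fxx[OF ab] by (simp add: k_def)
  \<comment> \<open>All three vanish at the vertex \<open>(x0, y0, u0)\<close>, so \<open>T\<close>
    sends it to the vertex \<open>(0, 1, 0)\<close> of the model.\<close>
  define \<tau> X G where "\<tau> v = \<beta> * (v $ 2 - y0)" and "X v = v $ 1 - x0 - \<tau> v * (a - x0)"
    and "G v = v $ 3 - u0 - \<tau> v * (F (a, b) - u0) - f1 * X v" for v :: "real ^ 3"
  define H where "H v = l * \<tau> v + m * X v + n * G v" for v
  define A :: "real ^ 3 ^ 3" where "A = vector [vector [1, - \<beta> * (a - x0), 0],
      vector [- m + n * f1, - l * \<beta> + m * \<beta> * (a - x0) + n * \<beta> * (F (a, b) - u0) - n * f1 * \<beta> * (a - x0), - n],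
      vector [- f1, - \<beta> * (F (a, b) - u0) + f1 * \<beta> * (a - x0), 1]]"
  define c :: "real ^ 3" where "c = vector [X 0, 1 - H 0, G 0]"
  define T where "T v = A *v v + c" for v
  have T: "T v $ 1 = X v" "T v $ 2 = 1 - H v" "T v $ 3 = G v" for v
    unfolding T_def
    by (simp_all add: matrix_vector_mult_3 A_def c_def X_def \<tau>_def G_def H_def algebra_simps)
  have "det A = - (l * \<beta>)"
    unfolding det_3 A_def by (simp add: algebra_simps)
  then have A: "invertible A"
    using k by0 by (simp add: invertible_det_nz l_def \<beta>_def)
  define gr where "gr v = F (v $ 1, v $ 2)" for v :: "real ^ 3"
  \<comment> \<open>The value of \<open>G\<close> at the point of the graph vertically above or
    below \<open>v\<close>.\<close>
  define K where "K v = G v + (gr v - v $ 3)" for v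
  define O' where "O' = {v :: real ^ 3. (v $ 1, v $ 2) \<in> V}"
  have on_graph: "K v * (l * \<tau> v + m * X v + n * K v) = (X v)\<^sup>2" if "v \<in> O'" for v
  proof -
    have "9 * k ^ 4 * (X v)\<^sup>2 = K v * (18 * k ^ 3 * \<tau> v - 6 * k\<^sup>2 * D_xxx F (a, b) * X v
        + (4 * (D_xxx F (a, b))\<^sup>2 - 3 * k * D_xxxx F (a, b)) * K v)"
      unfolding k_def
      by (rule conic[of "v $ 1" "v $ 2"])
        (use that in \<open>auto simp: O'_def \<tau>_def \<beta>_def X_def K_def G_def gr_def f1_def\<close>)
    moreover have "18 * k ^ 3 = 9 * k ^ 4 * l" "- 6 * k\<^sup>2 * D_xxx F (a, b) = 9 * k ^ 4 * m"
      "4 * (D_xxx F (a, b))\<^sup>2 - 3 * k * D_xxxx F (a, b) = 9 * k ^ 4 * n"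
      using k by (simp_all add: l_def m_def n_def field_simps power_numeral_reduce)
    ultimately have "9 * k ^ 4 * (X v)\<^sup>2 = 9 * k ^ 4 * (K v * (l * \<tau> v + m * X v + n * K v))"
      by algebra
    then show ?thesis using k by simp
  qed
  have "open O'"
  proof -
    have "open ((\<lambda>v :: real ^ 3. (v $ 1, v $ 2)) -` V)"
      by (rule open_vimage[OF V(1)]) (intro continuous_intros)
    then show ?thesis by (simp add: vimage_def O'_def)
  qed
  have "continuous_on V F"
    using real_analytic_on2_continuous[OF analytic] V(2)
    by (intro continuous_at_imp_continuous_on) blast
  then have cont_gr: "continuous_on O' gr"
    unfolding gr_def
    by (rule continuous_on_compose2) (auto simp: O'_def intro!: continuous_intros)
  \<comment> \<open>The second factor keeps \<open>v $ 3\<close> away from the other root of the quadratic equation.\<close>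
  define N where "N = O' \<inter> (\<lambda>v. H v * (l * \<tau> v + m * X v + n * (K v + G v))) -` (- {0})"
  have "open N"
    unfolding N_def
  proof (rule continuous_open_preimage[OF _ \<open>open O'\<close>])
    show "continuous_on O' (\<lambda>v. H v * (l * \<tau> v + m * X v + n * (K v + G v)))"
      unfolding K_def H_def G_def X_def \<tau>_def by (intro continuous_intros cont_gr)
  qed auto
  have "p \<in> N"
  proof -
    have "\<tau> p = 1" using by0 by (simp add: \<tau>_def \<beta>_def flip: b_def)
    moreover from this have "X p = 0" by (simp add: X_def flip: a_def)
    moreover from calculation have "G p = 0" by (simp add: G_def p3)
    moreover have "gr p = p $ 3" by (simp add: gr_def p3 flip: a_def b_def)
    ultimately show ?thesis
      using V(3) k by (simp add: N_def O'_def H_def K_def l_def flip: a_def b_def)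
  qed
  have iff: "T v \<in> model_surface \<longleftrightarrow> v \<in> graph_surface F U" if v: "v \<in> N" for v
  proof -
    have vO: "v \<in> O'" and nz: "H v \<noteq> 0" "l * \<tau> v + m * X v + n * (K v + G v) \<noteq> 0"
      using v by (auto simp: N_def)
    have "T v \<in> model_surface \<longleftrightarrow> G v * H v = (X v)\<^sup>2"
      using nz by (simp add: model_surface_iff T)
    \<comment> \<open>\<open>G v\<close> and \<open>K v\<close> enter the same quadratic expression;
      the difference of its two values has the factor \<open>G v - K v\<close>.\<close>
    also have "\<dots> \<longleftrightarrow> (G v - K v) * (l * \<tau> v + m * X v + n * (K v + G v)) = 0"
      using on_graph[OF vO] by (simp add: H_def algebra_simps)
    also have "\<dots> \<longleftrightarrow> v $ 3 = gr v" using nz by (auto simp: K_def)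
    also have "\<dots> \<longleftrightarrow> v \<in> graph_surface F U"
      using vO V(2) by (auto simp: graph_surface_iff gr_def O'_def)
    finally show ?thesis .
  qed
  have "openin (top_of_set model_surface) ((\<lambda>v. A *v v + c) ` (graph_surface F U \<inter> N))"
    by (rule openin_affine_image[OF A \<open>open N\<close>]) (use iff in \<open>simp add: T_def\<close>)
  moreover have "openin (top_of_set (graph_surface F U)) (graph_surface F U \<inter> N)"
    using \<open>open N\<close> by (rule openin_open_Int)
  ultimately show "\<exists>N A c. openin (top_of_set (graph_surface F U)) N \<and> p \<in> N \<and> invertible A \<and>
      openin (top_of_set model_surface) ((\<lambda>v. A *v v + c) ` N)"
    using A p \<open>p \<in> N\<close> by blast
qed

lemma conditions_of_locally_equivalent:
  assumes eq: "locally_affinely_equivalent (graph_surface F U) model_surface" and p: "p \<in> U"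
  shows "2 * D_xy F p * (D_xxx F p)\<^sup>2 - 2 * D_xx F p * D_xxx F p * D_xxy F p
       + (D_xx F p)\<^sup>2 * D_xxxy F p - D_xx F p * D_xy F p * D_xxxx F p = 0"
    and "9 * (D_xx F p)\<^sup>2 * D_xxxxx F p - 45 * D_xx F p * D_xxx F p * D_xxxx F p
       + 40 * (D_xxx F p) ^ 3 = 0"
proof -
  define lift :: "real \<times> real \<Rightarrow> real ^ 3" where "lift q = vector [fst q, snd q, F q]" for q
  have lift: "lift q \<in> graph_surface F U \<longleftrightarrow> q \<in> U" for q
    by (simp add: graph_surface_iff lift_def)
  obtain N A c where N: "openin (top_of_set (graph_surface F U)) N" "lift p \<in> N"
    and A: "invertible A"
    and M: "openin (top_of_set model_surface) ((\<lambda>v. A *v v + c) ` N)"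
    using eq p lift unfolding locally_affinely_equivalent_def by blast
  obtain N' where N': "open N'" "N = graph_surface F U \<inter> N'"
    using N(1) unfolding openin_open by blast
  \<comment> \<open>The surface neighbourhood is pulled back to the parameter plane, where the
    derivatives are taken.\<close>
  define V where "V = U \<inter> lift -` N'"
  have "continuous_on U F"
    using real_analytic_on2_continuous[OF analytic]
    by (intro continuous_at_imp_continuous_on) blast
  then have "continuous_on U (\<lambda>q. if i = 1 then fst q else if i = 2 then snd q else F q)" for i :: 3
    by (cases "i = 1"; cases "i = 2") (simp_all add: continuous_on_fst continuous_on_snd continuous_on_id)
  moreover have "lift = (\<lambda>q. \<chi> i :: 3. if i = 1 then fst q else if i = 2 then snd q else F q)"
    by (simp add: fun_eq_iff vec_eq_iff forall_3 lift_def)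
  ultimately have "continuous_on U lift" by (simp only: continuous_on_vec_lambda)
  then have "open V" unfolding V_def by (rule continuous_open_preimage[OF _ open_U N'(1)])
  moreover have "V \<subseteq> U" "(fst p, snd p) \<in> V" using N(2) N'(2) p by (auto simp: V_def)
  moreover have "A *v vector [x, y, F (x, y)] + c \<in> model_surface" if "(x, y) \<in> V" for x y
  proof -
    have "lift (x, y) \<in> N" using that lift by (simp add: V_def N'(2))
    then have "A *v lift (x, y) + c \<in> model_surface"
      using openin_subset[OF M] by auto
    then show ?thesis by (simp add: lift_def)
  qed
  ultimately show "2 * D_xy F p * (D_xxx F p)\<^sup>2 - 2 * D_xx F p * D_xxx F p * D_xxy F p
       + (D_xx F p)\<^sup>2 * D_xxxy F p - D_xx F p * D_xy F p * D_xxxx F p = 0"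
    and "9 * (D_xx F p)\<^sup>2 * D_xxxxx F p - 45 * D_xx F p * D_xxx F p * D_xxxx F p
       + 40 * (D_xxx F p) ^ 3 = 0"
    using conditions_of_equivalent[OF A, of V "fst p" "snd p" c] by simp_all
qed

end

theorem theorem5p1:
  fixes F :: "real \<times> real \<Rightarrow> real" and U :: "(real \<times> real) set"
  assumes "open U" and "connected U"
    and "real_analytic_on2 F U"
    and "\<forall>p\<in>U. D_xx F p \<noteq> 0"
    and "\<forall>p\<in>U. D_xx F p * D_xxy F p - D_xy F p * D_xxx F p \<noteq> 0"
    and "\<forall>p\<in>U. 0 = D_xx F p * D_yy F p - (D_xy F p)\<^sup>2"
  shows "locally_affinely_equivalent (graph_surface F U) model_surface \<longleftrightarrow>
    (\<forall>p\<in>U. 0 = 2 * D_xy F p * (D_xxx F p)\<^sup>2 - 2 * D_xx F p * D_xxx F p * D_xxy F p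
                + (D_xx F p)\<^sup>2 * D_xxxy F p - D_xx F p * D_xy F p * D_xxxx F p) \<and>
    (\<forall>p\<in>U. 0 = 9 * (D_xx F p)\<^sup>2 * D_xxxxx F p - 45 * D_xx F p * D_xxx F p * D_xxxx F p
                + 40 * (D_xxx F p) ^ 3)"
proof -
  interpret parabolic_graph F U
    using assms(1,3-6) by unfold_locales auto
  show ?thesis
  proof
    assume "locally_affinely_equivalent (graph_surface F U) model_surface"
    from conditions_of_locally_equivalent[OF this]
    show "(\<forall>p\<in>U. 0 = 2 * D_xy F p * (D_xxx F p)\<^sup>2 - 2 * D_xx F p * D_xxx F p * D_xxy F p
                + (D_xx F p)\<^sup>2 * D_xxxy F p - D_xx F p * D_xy F p * D_xxxx F p) \<and>
      (\<forall>p\<in>U. 0 = 9 * (D_xx F p)\<^sup>2 * D_xxxxx F p - 45 * D_xx F p * D_xxx F p * D_xxxx F p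
                + 40 * (D_xxx F p) ^ 3)"
      by simp
  qed (auto intro!: equivalent_of_conditions)
qed

end
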